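(* Let $C$ be a coalgebra over a field $\mathbb{K}$ and let $D$ be a subcoalgebra of $C$. (i) If $C$ is directly coreflexive, then so is $D$. (ii) If the rational left $C^*$-modules are closed under extensions in the category of all left $C^*$-modules (i.e. $C$ has a left torsion Rat functor), then the rational left $D^*$-modules are closed under extensions in the category of all left $D^*$-modules (i.e. $D$ has a left torsion Rat functor).
   Context: For a $\mathbb{K}$-coalgebra $C$, the dual $C^*$ is an algebra under convolution. A right $C$-comodule $M$ with coaction $m\mapsto \sum m_0\otimes m_1$ is a left $C^*$-module via $c^*\cdot m=\sum c^*(m_1)m_0$; the left $C^*$-modules arising this way are called rational. $C$ is directly coreflexive if the class of finite dimensional rational left $C^*$-modules is closed under extensions in the category of all left $C^*$-modules (this is equivalent to the same condition on the right). *)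

theory Defs
  imports "HOL-Algebra.AbelCoset" "Jordan_Normal_Form.Missing_VectorSpace"
begin

section \<open>Tensor products of vector spaces\<close>

text \<open>The ring components \<open>mult\<close> and \<open>one\<close> of a module record carry no meaning when the record
  is only used as a module; in the constructions below they are filled with junk.\<close>

definition free_module :: "('k, 'r) ring_scheme \<Rightarrow> 'a set \<Rightarrow> ('k, 'a \<Rightarrow> 'k) module" where
  "free_module K S =
    \<lparr>carrier = {f. (\<forall>x\<in>S. f x \<in> carrier K) \<and> (\<forall>x. x \<notin> S \<longrightarrow> f x = \<zero>\<^bsub>K\<^esub>)
                 \<and> finite {x. f x \<noteq> \<zero>\<^bsub>K\<^esub>}},
     mult = (\<lambda>f g x. \<zero>\<^bsub>K\<^esub>), one = (\<lambda>x. \<zero>\<^bsub>K\<^esub>),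
     zero = (\<lambda>x. \<zero>\<^bsub>K\<^esub>), add = (\<lambda>f g x. f x \<oplus>\<^bsub>K\<^esub> g x),
     smult = (\<lambda>a f x. a \<otimes>\<^bsub>K\<^esub> f x)\<rparr>"

definition free_gen :: "('k, 'r) ring_scheme \<Rightarrow> 'a \<Rightarrow> 'a \<Rightarrow> 'k" where
  "free_gen K x = (\<lambda>y. if y = x then \<one>\<^bsub>K\<^esub> else \<zero>\<^bsub>K\<^esub>)"

definition quotient_module :: "('k, 'v, 'x) module_scheme \<Rightarrow> 'v set \<Rightarrow> ('k, 'v set) module" where
  "quotient_module V W =
    \<lparr>carrier = a_rcosets\<^bsub>V\<^esub> W,
     mult = (\<lambda>X Y. W), one = W,
     zero = W, add = (\<lambda>X Y. X <+>\<^bsub>V\<^esub> Y),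
     smult = (\<lambda>a X. \<Union>x\<in>X. W +>\<^bsub>V\<^esub> (a \<odot>\<^bsub>V\<^esub> x))\<rparr>"

definition tensor_relations ::
  "('k, 'r) ring_scheme \<Rightarrow> ('k, 'm, 'x) module_scheme \<Rightarrow> ('k, 'n, 'y) module_scheme
    \<Rightarrow> ('m \<times> 'n \<Rightarrow> 'k) set" where
  "tensor_relations K M N =
    (let F = free_module K (carrier M \<times> carrier N); e = (\<lambda>m n. free_gen K (m, n)) in
      {e (m \<oplus>\<^bsub>M\<^esub> m') n \<ominus>\<^bsub>F\<^esub> (e m n \<oplus>\<^bsub>F\<^esub> e m' n) | m m' n.
          m \<in> carrier M \<and> m' \<in> carrier M \<and> n \<in> carrier N}
    \<union> {e m (n \<oplus>\<^bsub>N\<^esub> n') \<ominus>\<^bsub>F\<^esub> (e m n \<oplus>\<^bsub>F\<^esub> e m n') | m n n'.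
          m \<in> carrier M \<and> n \<in> carrier N \<and> n' \<in> carrier N}
    \<union> {e (a \<odot>\<^bsub>M\<^esub> m) n \<ominus>\<^bsub>F\<^esub> a \<odot>\<^bsub>F\<^esub> e m n | a m n.
          a \<in> carrier K \<and> m \<in> carrier M \<and> n \<in> carrier N}
    \<union> {e m (a \<odot>\<^bsub>N\<^esub> n) \<ominus>\<^bsub>F\<^esub> a \<odot>\<^bsub>F\<^esub> e m n | a m n.
          a \<in> carrier K \<and> m \<in> carrier M \<and> n \<in> carrier N})"

definition tensor_kernel ::
  "('k, 'r) ring_scheme \<Rightarrow> ('k, 'm, 'x) module_scheme \<Rightarrow> ('k, 'n, 'y) module_scheme
    \<Rightarrow> ('m \<times> 'n \<Rightarrow> 'k) set" where
  "tensor_kernel K M N =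
    module.span K (free_module K (carrier M \<times> carrier N)) (tensor_relations K M N)"

definition tensor ::
  "('k, 'r) ring_scheme \<Rightarrow> ('k, 'm, 'x) module_scheme \<Rightarrow> ('k, 'n, 'y) module_scheme
    \<Rightarrow> ('k, ('m \<times> 'n \<Rightarrow> 'k) set) module" where
  "tensor K M N =
    quotient_module (free_module K (carrier M \<times> carrier N)) (tensor_kernel K M N)"

definition pure_tensor ::
  "('k, 'r) ring_scheme \<Rightarrow> ('k, 'm, 'x) module_scheme \<Rightarrow> ('k, 'n, 'y) module_scheme
    \<Rightarrow> 'm \<Rightarrow> 'n \<Rightarrow> ('m \<times> 'n \<Rightarrow> 'k) set" where
  "pure_tensor K M N m n =
    tensor_kernel K M N +>\<^bsub>free_module K (carrier M \<times> carrier N)\<^esub> free_gen K (m, n)"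

text \<open>The linear map \<open>M \<otimes> N \<rightarrow> P\<close> induced by a bilinear map \<open>\<beta>\<close> (meaningful for bilinear \<open>\<beta>\<close> only).
  In Sweedler notation, \<open>tensor_lift K C C P \<beta> (\<Delta> c)\<close> is \<open>\<Sum> \<beta> c\<^sub>1 c\<^sub>2\<close>.\<close>

definition tensor_lift ::
  "('k, 'r) ring_scheme \<Rightarrow> ('k, 'm, 'x) module_scheme \<Rightarrow> ('k, 'n, 'y) module_scheme
    \<Rightarrow> ('k, 'p, 'z) module_scheme \<Rightarrow> ('m \<Rightarrow> 'n \<Rightarrow> 'p) \<Rightarrow> ('m \<times> 'n \<Rightarrow> 'k) set \<Rightarrow> 'p" where
  "tensor_lift K M N P \<beta> =
    (THE f. f \<in> module_hom K (tensor K M N) P \<inter> extensional (carrier (tensor K M N))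
          \<and> (\<forall>m\<in>carrier M. \<forall>n\<in>carrier N. f (pure_tensor K M N m n) = \<beta> m n))"

definition tensor_map ::
  "('k, 'r) ring_scheme \<Rightarrow> ('k, 'm, 'x) module_scheme \<Rightarrow> ('k, 'n, 'y) module_scheme
    \<Rightarrow> ('k, 'm2, 'x2) module_scheme \<Rightarrow> ('k, 'n2, 'y2) module_scheme
    \<Rightarrow> ('m \<Rightarrow> 'm2) \<Rightarrow> ('n \<Rightarrow> 'n2) \<Rightarrow> ('m \<times> 'n \<Rightarrow> 'k) set \<Rightarrow> ('m2 \<times> 'n2 \<Rightarrow> 'k) set" where
  "tensor_map K M N M' N' f g =
    tensor_lift K M N (tensor K M' N') (\<lambda>m n. pure_tensor K M' N' (f m) (g n))"

text \<open>The canonical isomorphism \<open>(L \<otimes> M) \<otimes> N \<rightarrow> L \<otimes> (M \<otimes> N)\<close>.\<close>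

definition tensor_assoc ::
  "('k, 'r) ring_scheme \<Rightarrow> ('k, 'l, 'w) module_scheme \<Rightarrow> ('k, 'm, 'x) module_scheme
    \<Rightarrow> ('k, 'n, 'y) module_scheme \<Rightarrow> (('l \<times> 'm \<Rightarrow> 'k) set \<times> 'n \<Rightarrow> 'k) set
    \<Rightarrow> ('l \<times> ('m \<times> 'n \<Rightarrow> 'k) set \<Rightarrow> 'k) set" where
  "tensor_assoc K L M N =
    tensor_lift K (tensor K L M) N (tensor K L (tensor K M N))
      (\<lambda>t n. tensor_lift K L M (tensor K L (tensor K M N))
        (\<lambda>l m. pure_tensor K L (tensor K M N) l (pure_tensor K M N m n)) t)"

definition regular_module :: "('k, 'r) ring_scheme \<Rightarrow> ('k, 'k) module" where
  "regular_module K =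
    \<lparr>carrier = carrier K, mult = mult K, one = \<one>\<^bsub>K\<^esub>, zero = \<zero>\<^bsub>K\<^esub>, add = add K, smult = mult K\<rparr>"


section \<open>Coalgebras, subcoalgebras and comodules\<close>

record ('k, 'c) coalgebra = "('k, 'c) module" +
  comult :: "'c \<Rightarrow> ('c \<times> 'c \<Rightarrow> 'k) set"
  counit :: "'c \<Rightarrow> 'k"

text \<open>In the counit axioms \<open>\<epsilon> \<otimes> id\<close> and \<open>id \<otimes> \<epsilon>\<close> are composed with the canonical isomorphisms
  \<open>K \<otimes> C \<cong> C\<close> and \<open>C \<otimes> K \<cong> C\<close>.\<close>

locale coalgebra = vectorspace K C
  for K :: "('k, 'r) ring_scheme" and C :: "('k, 'c, 'x) coalgebra_scheme" +
  assumes comult_hom: "comult C \<in> module_hom K C (tensor K C C)"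
    and counit_hom: "counit C \<in> module_hom K C (regular_module K)"
    and coassoc: "c \<in> carrier C \<Longrightarrow>
      tensor_assoc K C C C
        (tensor_map K C C (tensor K C C) C (comult C) (\<lambda>x. x) (comult C c)) =
      tensor_map K C C C (tensor K C C) (\<lambda>x. x) (comult C) (comult C c)"
    and counit_left: "c \<in> carrier C \<Longrightarrow>
      tensor_lift K C C C (\<lambda>a b. counit C a \<odot>\<^bsub>C\<^esub> b) (comult C c) = c"
    and counit_right: "c \<in> carrier C \<Longrightarrow>
      tensor_lift K C C C (\<lambda>a b. counit C b \<odot>\<^bsub>C\<^esub> a) (comult C c) = c"

definition tensor_square_incl ::
  "('k, 'r) ring_scheme \<Rightarrow> ('k, 'c, 'x) coalgebra_scheme \<Rightarrow> 'c set
    \<Rightarrow> ('c \<times> 'c \<Rightarrow> 'k) set \<Rightarrow> ('c \<times> 'c \<Rightarrow> 'k) set" where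
  "tensor_square_incl K C D =
    tensor_map K (C\<lparr>carrier := D\<rparr>) (C\<lparr>carrier := D\<rparr>) C C (\<lambda>x. x) (\<lambda>x. x)"

text \<open>\<open>\<Delta>(D) \<subseteq> D \<otimes> D\<close>, where \<open>D \<otimes> D\<close> is identified with its image in \<open>C \<otimes> C\<close>.\<close>

definition subcoalgebra ::
  "('k, 'r) ring_scheme \<Rightarrow> 'c set \<Rightarrow> ('k, 'c, 'x) coalgebra_scheme \<Rightarrow> bool" where
  "subcoalgebra K D C \<longleftrightarrow> subspace K D C \<and>
    comult C ` D \<subseteq>
      tensor_square_incl K C D ` carrier (tensor K (C\<lparr>carrier := D\<rparr>) (C\<lparr>carrier := D\<rparr>))"

text \<open>The coalgebra structure of a subcoalgebra. Tensors are cosets of functions that vanish outside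
  the product of the carriers, so \<open>D \<otimes> D\<close> is not literally a subset of \<open>C \<otimes> C\<close> and the
  comultiplication has to be pulled back along the (injective) map \<open>D \<otimes> D \<rightarrow> C \<otimes> C\<close>.\<close>

definition subcoalgebra_struct ::
  "('k, 'r) ring_scheme \<Rightarrow> ('k, 'c, 'x) coalgebra_scheme \<Rightarrow> 'c set
    \<Rightarrow> ('k, 'c, 'x) coalgebra_scheme" where
  "subcoalgebra_struct K C D =
    C\<lparr>carrier := D,
      comult := (\<lambda>d. THE t. t \<in> carrier (tensor K (C\<lparr>carrier := D\<rparr>) (C\<lparr>carrier := D\<rparr>))
                     \<and> tensor_square_incl K C D t = comult C d)\<rparr>"

locale right_comodule = C?: coalgebra K C + M?: vectorspace K M
  for K :: "('k, 'r) ring_scheme" and C :: "('k, 'c, 'x) coalgebra_scheme"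
    and M :: "('k, 'm, 'y) module_scheme" +
  fixes \<rho> :: "'m \<Rightarrow> ('m \<times> 'c \<Rightarrow> 'k) set"
  assumes coaction_hom: "\<rho> \<in> module_hom K M (tensor K M C)"
    and coaction_coassoc: "m \<in> carrier M \<Longrightarrow>
      tensor_assoc K M C C (tensor_map K M C (tensor K M C) C \<rho> (\<lambda>x. x) (\<rho> m)) =
      tensor_map K M C M (tensor K C C) (\<lambda>x. x) (comult C) (\<rho> m)"
    and coaction_counit: "m \<in> carrier M \<Longrightarrow>
      tensor_lift K M C M (\<lambda>x c. counit C c \<odot>\<^bsub>M\<^esub> x) (\<rho> m) = m"


section \<open>The dual algebra and rational modules\<close>

text \<open>Linear functionals are represented by functions that are \<open>undefined\<close> outside \<open>carrier C\<close>.\<close>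

definition dual_algebra ::
  "('k, 'r) ring_scheme \<Rightarrow> ('k, 'c, 'x) coalgebra_scheme \<Rightarrow> ('k, 'c \<Rightarrow> 'k) module" where
  "dual_algebra K C =
    \<lparr>carrier = module_hom K C (regular_module K) \<inter> extensional (carrier C),
     mult = (\<lambda>f g. \<lambda>c\<in>carrier C.
       tensor_lift K C C (regular_module K) (\<lambda>a b. f a \<otimes>\<^bsub>K\<^esub> g b) (comult C c)),
     one = (\<lambda>c\<in>carrier C. counit C c),
     zero = (\<lambda>c\<in>carrier C. \<zero>\<^bsub>K\<^esub>),
     add = (\<lambda>f g. \<lambda>c\<in>carrier C. f c \<oplus>\<^bsub>K\<^esub> g c),
     smult = (\<lambda>a f. \<lambda>c\<in>carrier C. a \<otimes>\<^bsub>K\<^esub> f c)\<rparr>"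

text \<open>The locale \<^locale>\<open>module\<close> requires a commutative ring of scalars.\<close>

locale left_module = R?: ring R + M?: abelian_group M
  for R :: "('a, 'r) ring_scheme" (structure) and M :: "('a, 'm, 'x) module_scheme" (structure) +
  assumes smult_closed: "\<lbrakk>a \<in> carrier R; x \<in> carrier M\<rbrakk> \<Longrightarrow> a \<odot>\<^bsub>M\<^esub> x \<in> carrier M"
    and smult_l_distr: "\<lbrakk>a \<in> carrier R; b \<in> carrier R; x \<in> carrier M\<rbrakk> \<Longrightarrow>
      (a \<oplus> b) \<odot>\<^bsub>M\<^esub> x = a \<odot>\<^bsub>M\<^esub> x \<oplus>\<^bsub>M\<^esub> b \<odot>\<^bsub>M\<^esub> x"
    and smult_r_distr: "\<lbrakk>a \<in> carrier R; x \<in> carrier M; y \<in> carrier M\<rbrakk> \<Longrightarrow>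
      a \<odot>\<^bsub>M\<^esub> (x \<oplus>\<^bsub>M\<^esub> y) = a \<odot>\<^bsub>M\<^esub> x \<oplus>\<^bsub>M\<^esub> a \<odot>\<^bsub>M\<^esub> y"
    and smult_assoc: "\<lbrakk>a \<in> carrier R; b \<in> carrier R; x \<in> carrier M\<rbrakk> \<Longrightarrow>
      (a \<otimes> b) \<odot>\<^bsub>M\<^esub> x = a \<odot>\<^bsub>M\<^esub> (b \<odot>\<^bsub>M\<^esub> x)"
    and smult_one: "x \<in> carrier M \<Longrightarrow> \<one> \<odot>\<^bsub>M\<^esub> x = x"

text \<open>The vector space underlying a left module \<open>M\<close> over a \<open>K\<close>-algebra \<open>A\<close>, with scalars acting
  through the unit map \<open>K \<rightarrow> A\<close>, \<open>a \<mapsto> a \<cdot> 1\<close>.\<close>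

definition base_space ::
  "('k, 'a, 'x) module_scheme \<Rightarrow> ('a, 'm, 'y) module_scheme \<Rightarrow> ('k, 'm) module" where
  "base_space A M =
    \<lparr>carrier = carrier M, mult = mult M, one = \<one>\<^bsub>M\<^esub>, zero = \<zero>\<^bsub>M\<^esub>, add = add M,
     smult = (\<lambda>a x. (a \<odot>\<^bsub>A\<^esub> \<one>\<^bsub>A\<^esub>) \<odot>\<^bsub>M\<^esub> x)\<rparr>"

text \<open>\<open>c\<^sup>* \<cdot> m = \<Sum> c\<^sup>*(m\<^sub>1) m\<^sub>0\<close>\<close>

definition comodule_action ::
  "('k, 'r) ring_scheme \<Rightarrow> ('k, 'c, 'x) coalgebra_scheme \<Rightarrow> ('k, 'm, 'y) module_scheme
    \<Rightarrow> ('m \<Rightarrow> ('m \<times> 'c \<Rightarrow> 'k) set) \<Rightarrow> ('c \<Rightarrow> 'k) \<Rightarrow> 'm \<Rightarrow> 'm" where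
  "comodule_action K C M \<rho> f m = tensor_lift K M C M (\<lambda>x c. f c \<odot>\<^bsub>M\<^esub> x) (\<rho> m)"

text \<open>The action of \<open>a \<cdot> \<epsilon>\<close> that comes from a comodule is the scalar action of \<open>a\<close>, so the underlying
  vector space of a comodule inducing \<open>M\<close> can only be \<open>base_space (dual_algebra K C) M\<close>.\<close>

definition rational_module ::
  "('k, 'r) ring_scheme \<Rightarrow> ('k, 'c, 'x) coalgebra_scheme \<Rightarrow> ('c \<Rightarrow> 'k, 'm, 'y) module_scheme
    \<Rightarrow> bool" where
  "rational_module K C M \<longleftrightarrow>
    left_module (dual_algebra K C) M \<and>
    (\<exists>\<rho>. right_comodule K C (base_space (dual_algebra K C) M) \<rho> \<and>
      (\<forall>f\<in>carrier (dual_algebra K C). \<forall>m\<in>carrier M.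
        f \<odot>\<^bsub>M\<^esub> m = comodule_action K C (base_space (dual_algebra K C) M) \<rho> f m))"


section \<open>Closure under extensions\<close>

definition short_exact ::
  "('a, 'r) ring_scheme \<Rightarrow> ('a, 'l, 'x) module_scheme \<Rightarrow> ('l \<Rightarrow> 'm) \<Rightarrow> ('a, 'm, 'y) module_scheme
    \<Rightarrow> ('m \<Rightarrow> 'n) \<Rightarrow> ('a, 'n, 'z) module_scheme \<Rightarrow> bool" where
  "short_exact R L i M p N \<longleftrightarrow>
    i \<in> module_hom R L M \<and> p \<in> module_hom R M N \<and>
    inj_on i (carrier L) \<and>
    i ` carrier L = {x \<in> carrier M. p x = \<zero>\<^bsub>N\<^esub>} \<and>
    p ` carrier M = carrier N"

text \<open>HOL cannot quantify over types inside a formula, so \<open>the category of all left \<open>R\<close>-modules\<close>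
  means all left \<open>R\<close>-modules whose carrier is a subset of the type \<open>'m\<close>, which is a parameter of
  the notions below (as the type argument of \<open>P\<close>, or as an argument of type \<open>'m itself\<close>).
  Up to isomorphism, the outer terms of an extension live in any type in which the middle term lives,
  so it is no restriction to take all three terms in \<open>'m\<close>.\<close>

definition closed_under_extensions ::
  "('a, 'r) ring_scheme \<Rightarrow> (('a, 'm) module \<Rightarrow> bool) \<Rightarrow> bool" where
  "closed_under_extensions R P \<longleftrightarrow>
    (\<forall>L M N i p. left_module R L \<and> left_module R M \<and> left_module R N \<and>
      short_exact R L i M p N \<and> P L \<and> P N \<longrightarrow> P M)"

definition directly_coreflexive ::
  "'m itself \<Rightarrow> ('k, 'r) ring_scheme \<Rightarrow> ('k, 'c, 'x) coalgebra_scheme \<Rightarrow> bool" where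
  "directly_coreflexive _ K C \<longleftrightarrow>
    closed_under_extensions (dual_algebra K C)
      (\<lambda>M :: ('c \<Rightarrow> 'k, 'm) module.
        rational_module K C M \<and> vectorspace.fin_dim K (base_space (dual_algebra K C) M))"

definition left_torsion_Rat ::
  "'m itself \<Rightarrow> ('k, 'r) ring_scheme \<Rightarrow> ('k, 'c, 'x) coalgebra_scheme \<Rightarrow> bool" where
  "left_torsion_Rat _ K C \<longleftrightarrow>
    closed_under_extensions (dual_algebra K C)
      (\<lambda>M :: ('c \<Rightarrow> 'k, 'm) module. rational_module K C M)"

end

theory Submission
  imports Defs
begin

text \<open>A left \<open>C\<^sup>*\<close>-module \<open>M\<close> is rational iff for every \<open>m\<close> there are finitely many pairs \<open>(m\<^sub>i, c\<^sub>i)\<close>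
  with \<open>f \<cdot> m = \<Sum> f(c\<^sub>i) m\<^sub>i\<close> for all \<open>f \<in> C\<^sup>*\<close>. Inflating an extension of rational \<open>D\<^sup>*\<close>-modules along the
  restriction \<open>C\<^sup>* \<rightarrow> D\<^sup>*\<close> gives an extension of rational \<open>C\<^sup>*\<close>-modules on the same vector spaces, so its
  middle term is rational over \<open>C\<close>. A linear projection \<open>C \<rightarrow> D\<close> lets every functional on \<open>D\<close> be extended
  to \<open>C\<close>, and replacing each \<open>c\<^sub>i\<close> by its projection shows that the middle term is rational over \<open>D\<close>.\<close>

text \<open>Tensors are cosets of finitely supported functions, and \<open>tensor_lift\<close>,
  \<open>tensor_map\<close> and \<open>tensor_assoc\<close> are unique choices, so equations in
  iterated tensor products, coassociativity above all, are hard to handle directly. They are tested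
  with functionals instead: if N is a vector space, a tensor t in M \<otimes> N is determined by the
  elements \<open>contract K M N f t\<close> of M, where f runs through the functionals on N.
  Contracting coassociativity with f and g turns it into f (g m) = (f * g) m. This one criterion
  yields the associativity of the dual algebra, the coassociativity of D and that of a coaction
  rebuilt from coefficient lists.

  Coefficient lists are preferred to coactions because passing from C to D then only changes the
  second entries of the pairs; otherwise the coaction of the middle term would have to be shown to
  land in the image of M \<otimes> D.

  The field is essential through complements of subspaces, found by Zorn's lemma. They give the
  functionals that separate tensors and the projection onto D. The projection also makes D \<otimes>
  D \<rightarrow> C \<otimes> C injective, without which the comultiplication of D, a definite
  description, would be meaningless.\<close>

lemma module_homI:
  assumes "\<And>x. x \<in> carrier M \<Longrightarrow> f x \<in> carrier N"
    and "\<And>x y. \<lbrakk>x \<in> carrier M; y \<in> carrier M\<rbrakk> \<Longrightarrow> f (x \<oplus>\<^bsub>M\<^esub> y) = f x \<oplus>\<^bsub>N\<^esub> f y"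
    and "\<And>a x. \<lbrakk>a \<in> carrier R; x \<in> carrier M\<rbrakk> \<Longrightarrow> f (a \<odot>\<^bsub>M\<^esub> x) = a \<odot>\<^bsub>N\<^esub> f x"
  shows "f \<in> module_hom R M N"
  using assms by (auto simp: module_hom_def)

lemma module_hom_in_carrier: "\<lbrakk>f \<in> module_hom R M N; x \<in> carrier M\<rbrakk> \<Longrightarrow> f x \<in> carrier N"
  by (auto simp: module_hom_def)

lemma module_hom_zero:
  assumes "module K M" "module K N" "f \<in> module_hom K M N"
  shows "f \<zero>\<^bsub>M\<^esub> = \<zero>\<^bsub>N\<^esub>"
proof -
  interpret mod_hom K M N f
    using assms by (simp add: mod_hom_def mod_hom_axioms_def)
  show ?thesis by (rule f0_is_0)
qed

lemma module_hom_compose: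
  "\<lbrakk>f \<in> module_hom R L M; g \<in> module_hom R M N\<rbrakk> \<Longrightarrow> (\<lambda>x. g (f x)) \<in> module_hom R L N"
  by (auto simp: module_hom_def Pi_iff)

section \<open>The base ring as a module over itself\<close>

lemma regular_module_simps [simp]:
  "carrier (regular_module K) = carrier K" "\<zero>\<^bsub>regular_module K\<^esub> = \<zero>\<^bsub>K\<^esub>"
  "x \<oplus>\<^bsub>regular_module K\<^esub> y = x \<oplus>\<^bsub>K\<^esub> y" "a \<odot>\<^bsub>regular_module K\<^esub> y = a \<otimes>\<^bsub>K\<^esub> y"
  by (simp_all add: regular_module_def)

lemma module_regular_module:
  assumes "cring K"
  shows "module K (regular_module K)"
proof -
  interpret cring K by fact
  show ?thesis
    by (rule moduleI, fact, rule abelian_groupI)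
       (auto simp: a_ac m_assoc l_distr r_distr intro: l_neg exI[of _ "\<ominus>\<^bsub>K\<^esub> _"])
qed

section \<open>Sums over lists\<close>

text \<open>A list sum instead of a sum over a finite set: tensors are represented by lists of
  pairs, possibly with repetitions. It reads only \<open>add\<close> and \<open>zero\<close> of the
  record, so records that share these two fields have literally the same \<open>lsum\<close>, with
  no condition on carriers.\<close>

definition lsum :: "('p, 'z) ring_scheme \<Rightarrow> ('i \<Rightarrow> 'p) \<Rightarrow> 'i list \<Rightarrow> 'p" where
  "lsum P f xs = foldr (\<lambda>i s. f i \<oplus>\<^bsub>P\<^esub> s) xs \<zero>\<^bsub>P\<^esub>"

lemma lsum_Nil [simp]: "lsum P f [] = \<zero>\<^bsub>P\<^esub>"
  and lsum_Cons [simp]: "lsum P f (x # xs) = f x \<oplus>\<^bsub>P\<^esub> lsum P f xs"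
  by (simp_all add: lsum_def)

lemma lsum_cong: "(\<And>x. x \<in> set xs \<Longrightarrow> f x = g x) \<Longrightarrow> lsum P f xs = lsum P g xs"
  by (induction xs) auto

lemma lsum_map: "lsum P f (map h xs) = lsum P (\<lambda>x. f (h x)) xs"
  by (induction xs) auto

lemma (in abelian_monoid) lsum_closed:
  "(\<And>x. x \<in> set xs \<Longrightarrow> f x \<in> carrier G) \<Longrightarrow> lsum G f xs \<in> carrier G"
  by (induction xs) auto

lemma lsum_hom:
  assumes "module K M" "module K N" "h \<in> module_hom K M N"
    and "\<And>x. x \<in> set xs \<Longrightarrow> f x \<in> carrier M"
  shows "h (lsum M f xs) = lsum N (\<lambda>x. h (f x)) xs"
proof -
  interpret M: module K M by fact
  show ?thesis
    using assms(4)
    by (induction xs)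
       (auto simp: module_hom_zero[OF assms(1-3)] module_hom_add[OF assms(3)] M.lsum_closed)
qed

section \<open>Free modules and quotients\<close>

lemma free_module_simps [simp]:
  "\<zero>\<^bsub>free_module K S\<^esub> = (\<lambda>x. \<zero>\<^bsub>K\<^esub>)"
  "f \<oplus>\<^bsub>free_module K S\<^esub> g = (\<lambda>x. f x \<oplus>\<^bsub>K\<^esub> g x)"
  "a \<odot>\<^bsub>free_module K S\<^esub> f = (\<lambda>x. a \<otimes>\<^bsub>K\<^esub> f x)"
  by (simp_all add: free_module_def)

lemma free_module_carrier:
  "f \<in> carrier (free_module K S) \<longleftrightarrow>
    (\<forall>x\<in>S. f x \<in> carrier K) \<and> (\<forall>x. x \<notin> S \<longrightarrow> f x = \<zero>\<^bsub>K\<^esub>) \<and> finite {x. f x \<noteq> \<zero>\<^bsub>K\<^esub>}"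
  by (simp add: free_module_def)

lemma (in cring) free_module_in_carrier: "f \<in> carrier (free_module R S) \<Longrightarrow> f x \<in> carrier R"
  by (cases "x \<in> S") (auto simp: free_module_carrier)

lemma (in cring) module_free_module: "module R (free_module R S)"
proof (rule moduleI)
  show "cring R" by (rule is_cring)
  have add: "(\<lambda>x. f x \<oplus> g x) \<in> carrier (free_module R S)"
    if "f \<in> carrier (free_module R S)" "g \<in> carrier (free_module R S)" for f g
    using that
    by (auto simp: free_module_carrier intro: finite_subset[of _ "{x. f x \<noteq> \<zero>} \<union> {x. g x \<noteq> \<zero>}"])
  have smult: "(\<lambda>x. a \<otimes> f x) \<in> carrier (free_module R S)"
    if "a \<in> carrier R" "f \<in> carrier (free_module R S)" for a f
    using that
    by (auto simp: free_module_carrier intro: finite_subset[of _ "{x. f x \<noteq> \<zero>}"])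
  show "a \<odot>\<^bsub>free_module R S\<^esub> f \<in> carrier (free_module R S)"
    if "a \<in> carrier R" "f \<in> carrier (free_module R S)" for a f
    using smult that by simp
  show "abelian_group (free_module R S)"
  proof (rule abelian_groupI)
    fix f assume f: "f \<in> carrier (free_module R S)"
    have "(\<lambda>x. \<ominus> \<one> \<otimes> f x) \<in> carrier (free_module R S)"
      by (rule smult) (use f in auto)
    then show "\<exists>g\<in>carrier (free_module R S). g \<oplus>\<^bsub>free_module R S\<^esub> f = \<zero>\<^bsub>free_module R S\<^esub>"
      using f by (intro bexI[of _ "\<lambda>x. \<ominus> \<one> \<otimes> f x"])
        (auto simp: l_minus l_neg free_module_in_carrier)
  qed (auto simp: add a_ac free_module_in_carrier fun_eq_iff, auto simp: free_module_carrier)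
qed (auto simp: free_module_in_carrier l_distr r_distr m_assoc)

lemma (in cring) free_gen_in_carrier: "x \<in> S \<Longrightarrow> free_gen R x \<in> carrier (free_module R S)"
  by (auto simp: free_module_carrier free_gen_def)

text \<open>Induction on the size of the support: resetting f to zero at one point x of its support
  leaves g, and f is recovered by adding the multiple f x of the generator at x.\<close>

lemma (in cring) free_module_induct [consumes 1, case_names zero add]:
  assumes "f \<in> carrier (free_module R S)"
    and zero: "P \<zero>\<^bsub>free_module R S\<^esub>"
    and add: "\<And>a x g. \<lbrakk>a \<in> carrier R; x \<in> S; g \<in> carrier (free_module R S); P g\<rbrakk> \<Longrightarrow>
      P ((a \<odot>\<^bsub>free_module R S\<^esub> free_gen R x) \<oplus>\<^bsub>free_module R S\<^esub> g)"
  shows "P f"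
proof -
  have "finite {x. f x \<noteq> \<zero>}"
    using assms(1) by (simp add: free_module_carrier)
  then show ?thesis
    using assms(1)
  proof (induction "{x. f x \<noteq> \<zero>}" arbitrary: f rule: finite_induct)
    case empty
    then have "f = (\<lambda>x. \<zero>)" by auto
    then show ?case using zero by simp
  next
    case (insert x A)
    define g where "g = f(x := \<zero>)"
    have A: "A = {y. g y \<noteq> \<zero>}"
      using insert(2,4) by (auto simp: g_def)
    have x: "x \<in> S"
      using insert(4,5) by (auto simp: free_module_carrier)
    have g: "g \<in> carrier (free_module R S)"
      using insert(1,5) A by (auto simp: free_module_carrier g_def)
    have "f = (\<lambda>y. f x \<otimes> free_gen R x y \<oplus> g y)"
      using insert(5) by (auto simp: fun_eq_iff g_def free_gen_def free_module_in_carrier)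
    moreover have "P ((f x \<odot>\<^bsub>free_module R S\<^esub> free_gen R x) \<oplus>\<^bsub>free_module R S\<^esub> g)"
      by (rule add) (use insert g A x in \<open>auto simp: free_module_in_carrier\<close>)
    ultimately show ?case by simp
  qed
qed

text \<open>The universal property of the free module, with the extension given by the finite sum of
  all f x \<beta> x over the support of f.\<close>

lemma (in cring) free_module_lift:
  assumes "module R P" and \<beta>: "\<And>x. x \<in> S \<Longrightarrow> \<beta> x \<in> carrier P"
  shows "\<exists>h\<in>module_hom R (free_module R S) P. \<forall>x\<in>S. h (free_gen R x) = \<beta> x"
proof -
  interpret P: module R P by fact
  define h where "h f = (\<Oplus>\<^bsub>P\<^esub>x\<in>{x. f x \<noteq> \<zero>}. f x \<odot>\<^bsub>P\<^esub> \<beta> x)" for f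
  \<comment> \<open>Supports vary with f. Allowing any finite index set that contains the support
    lets f, g and their sum be evaluated over a common one.\<close>
  have h_eq: "h f = (\<Oplus>\<^bsub>P\<^esub>x\<in>A. f x \<odot>\<^bsub>P\<^esub> \<beta> x)"
    if "finite A" "A \<subseteq> S" "{x. f x \<noteq> \<zero>} \<subseteq> A" "f \<in> carrier (free_module R S)" for f A
    unfolding h_def
    by (rule P.add.finprod_mono_neutral_cong_left)
      (use that \<beta> P.smult_l_null in \<open>auto simp: free_module_in_carrier subset_iff\<close>)
  have supp: "finite {x. f x \<noteq> \<zero>}" "{x. f x \<noteq> \<zero>} \<subseteq> S" if "f \<in> carrier (free_module R S)" for f
    using that by (auto simp: free_module_carrier)
  interpret F: module R "free_module R S" by (rule module_free_module)
  show ?thesis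
  proof (intro bexI[of _ h] module_homI ballI)
    fix f assume f: "f \<in> carrier (free_module R S)"
    show "h f \<in> carrier P"
      unfolding h_def using supp[OF f] f
      by (intro P.finsum_closed) (auto simp: free_module_in_carrier intro!: \<beta>)
  next
    fix f g assume f: "f \<in> carrier (free_module R S)" and g: "g \<in> carrier (free_module R S)"
    let ?A = "{x. f x \<noteq> \<zero>} \<union> {x. g x \<noteq> \<zero>}"
    have A: "finite ?A" "?A \<subseteq> S" using supp f g by auto
    have "h (f \<oplus>\<^bsub>free_module R S\<^esub> g) = (\<Oplus>\<^bsub>P\<^esub>x\<in>?A. (f x \<oplus> g x) \<odot>\<^bsub>P\<^esub> \<beta> x)"
      using F.add.m_closed[OF f g] A by (subst h_eq[of ?A]) auto
    also have "\<dots> = (\<Oplus>\<^bsub>P\<^esub>x\<in>?A. f x \<odot>\<^bsub>P\<^esub> \<beta> x \<oplus>\<^bsub>P\<^esub> g x \<odot>\<^bsub>P\<^esub> \<beta> x)"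
      using f g A \<beta> by (intro P.add.finprod_cong')
       (auto simp: P.smult_l_distr free_module_in_carrier subset_iff)
    also have "\<dots> = h f \<oplus>\<^bsub>P\<^esub> h g"
      using f g A \<beta> by (subst P.finsum_addf)
       (auto simp: h_eq[of ?A] free_module_in_carrier subset_iff)
    finally show "h (f \<oplus>\<^bsub>free_module R S\<^esub> g) = h f \<oplus>\<^bsub>P\<^esub> h g" .
  next
    fix a f assume a: "a \<in> carrier R" and f: "f \<in> carrier (free_module R S)"
    let ?A = "{x. f x \<noteq> \<zero>}"
    have "h (a \<odot>\<^bsub>free_module R S\<^esub> f) = (\<Oplus>\<^bsub>P\<^esub>x\<in>?A. (a \<otimes> f x) \<odot>\<^bsub>P\<^esub> \<beta> x)"
      using F.smult_closed[OF a f] supp[OF f] a by (subst h_eq[of ?A]) auto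
    also have "\<dots> = (\<Oplus>\<^bsub>P\<^esub>x\<in>?A. a \<odot>\<^bsub>P\<^esub> (f x \<odot>\<^bsub>P\<^esub> \<beta> x))"
      using a f supp[OF f] \<beta> by (intro P.add.finprod_cong')
       (auto simp: P.smult_assoc1 free_module_in_carrier subset_iff)
    also have "\<dots> = a \<odot>\<^bsub>P\<^esub> h f"
      using a f supp[OF f] \<beta> by (subst P.finsum_smult_ldistr[symmetric])
        (auto simp: h_def free_module_in_carrier subset_iff)
    finally show "h (a \<odot>\<^bsub>free_module R S\<^esub> f) = a \<odot>\<^bsub>P\<^esub> h f" .
  next
    fix x assume x: "x \<in> S"
    have "h (free_gen R x) = (\<Oplus>\<^bsub>P\<^esub>y\<in>{x}. free_gen R x y \<odot>\<^bsub>P\<^esub> \<beta> y)"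
      by (rule h_eq) (auto simp: free_gen_in_carrier x, auto simp: free_gen_def split: if_splits)
    then show "h (free_gen R x) = \<beta> x"
      using \<beta>[OF x] by (simp add: free_gen_def)
  qed
qed

section \<open>Quotient modules, computed on representatives\<close>

locale module_quotient = V?: module K V for K :: "('k, 'r) ring_scheme" and V :: "('k, 'v, 'x) module_scheme" +
  fixes W
  assumes submodule: "submodule K W V"
begin

sublocale W: abelian_subgroup W V
proof (rule abelian_subgroupI3)
  have "\<ominus>\<^bsub>V\<^esub> x \<in> W" if "x \<in> W" for x
  proof -
    have "x \<in> carrier V" using submodule that by (auto simp: submodule_def)
    moreover have "(\<ominus>\<^bsub>K\<^esub> \<one>\<^bsub>K\<^esub>) \<odot>\<^bsub>V\<^esub> x \<in> W"
      using submodule that by (auto simp: submodule_def)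
    ultimately show ?thesis by (simp add: smult_l_minus)
  qed
  then show "additive_subgroup W V"
    using submodule
    by unfold_locales (auto simp: submodule_def subset_iff a_inv_def)
  show "abelian_group V" ..
qed

abbreviation Q where "Q \<equiv> quotient_module V W"

lemma quotient_carrier: "X \<in> carrier Q \<longleftrightarrow> (\<exists>x\<in>carrier V. X = W +>\<^bsub>V\<^esub> x)"
  by (auto simp: quotient_module_def A_RCOSETS_def')

lemma quotient_zero: "\<zero>\<^bsub>Q\<^esub> = W +>\<^bsub>V\<^esub> \<zero>\<^bsub>V\<^esub>"
  using W.a_subset by (simp add: quotient_module_def)

lemma quotient_add: "\<lbrakk>x \<in> carrier V; y \<in> carrier V\<rbrakk> \<Longrightarrow>
  (W +>\<^bsub>V\<^esub> x) \<oplus>\<^bsub>Q\<^esub> (W +>\<^bsub>V\<^esub> y) = W +>\<^bsub>V\<^esub> (x \<oplus>\<^bsub>V\<^esub> y)"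
  by (simp add: quotient_module_def W.a_rcos_sum)

lemma coset_eqI: "\<lbrakk>x \<in> carrier V; w \<in> W\<rbrakk> \<Longrightarrow> W +>\<^bsub>V\<^esub> (w \<oplus>\<^bsub>V\<^esub> x) = W +>\<^bsub>V\<^esub> x"
  by (rule W.a_repr_independence'[symmetric]) (auto simp: a_r_coset_def')

text \<open>The pointwise multiples of a coset need not form a coset (for a = 0 they are just zero),
  which is why \<open>quotient_module\<close> takes the union of the cosets of these multiples. All
  of them coincide, since representatives differ by elements of W and W is stable under
  scalars.\<close>

lemma quotient_smult:
  assumes "a \<in> carrier K" "x \<in> carrier V"
  shows "a \<odot>\<^bsub>Q\<^esub> (W +>\<^bsub>V\<^esub> x) = W +>\<^bsub>V\<^esub> (a \<odot>\<^bsub>V\<^esub> x)"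
proof -
  have *: "W +>\<^bsub>V\<^esub> (a \<odot>\<^bsub>V\<^esub> y) = W +>\<^bsub>V\<^esub> (a \<odot>\<^bsub>V\<^esub> x)" if "y \<in> W +>\<^bsub>V\<^esub> x" for y
  proof -
    obtain w where w: "w \<in> W" "y = w \<oplus>\<^bsub>V\<^esub> x"
      using \<open>y \<in> _\<close> by (auto simp: a_r_coset_def')
    then have "a \<odot>\<^bsub>V\<^esub> y = (a \<odot>\<^bsub>V\<^esub> w) \<oplus>\<^bsub>V\<^esub> (a \<odot>\<^bsub>V\<^esub> x)"
      using assms by (simp add: smult_r_distr)
    moreover have "a \<odot>\<^bsub>V\<^esub> w \<in> W" using submodule assms w by (auto simp: submodule_def)
    ultimately show ?thesis using assms by (simp add: coset_eqI)
  qed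
  have "x \<in> W +>\<^bsub>V\<^esub> x" using assms W.a_rcos_self by simp
  then have "(\<Union>y\<in>W +>\<^bsub>V\<^esub> x. W +>\<^bsub>V\<^esub> (a \<odot>\<^bsub>V\<^esub> y)) = W +>\<^bsub>V\<^esub> (a \<odot>\<^bsub>V\<^esub> x)"
    by (intro SUP_eq_const) (auto dest: *)
  then show ?thesis
    by (simp add: quotient_module_def)
qed

lemma module_quotient_module: "module K Q"
proof (rule moduleI)
  show "cring K" ..
  show "abelian_group Q"
  proof (rule abelian_groupI)
    fix X assume "X \<in> carrier Q"
    then obtain x where "x \<in> carrier V" "X = W +>\<^bsub>V\<^esub> x" by (auto simp: quotient_carrier)
    then show "\<exists>Y\<in>carrier Q. Y \<oplus>\<^bsub>Q\<^esub> X = \<zero>\<^bsub>Q\<^esub>"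
      by (intro bexI[of _ "W +>\<^bsub>V\<^esub> (\<ominus>\<^bsub>V\<^esub> x)"])
         (auto simp: quotient_carrier quotient_zero quotient_add V.M.l_neg)
  qed (fastforce simp: quotient_carrier quotient_zero quotient_add V.M.a_ac)+
qed (fastforce simp: quotient_carrier quotient_add quotient_smult smult_l_distr smult_r_distr
      smult_assoc1)+

lemma quotient_lift:
  assumes "module K P" "h \<in> module_hom K V P" "\<And>w. w \<in> W \<Longrightarrow> h w = \<zero>\<^bsub>P\<^esub>"
  shows "\<exists>g\<in>module_hom K Q P. \<forall>x\<in>carrier V. g (W +>\<^bsub>V\<^esub> x) = h x"
proof -
  interpret P: module K P by fact
  \<comment> \<open>The chosen representative is irrelevant: another one differs by an element of W,
    and h vanishes there.\<close>
  define g where "g X = h (SOME x. x \<in> X)" for X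
  have g: "g (W +>\<^bsub>V\<^esub> x) = h x" if x: "x \<in> carrier V" for x
  proof -
    have "x \<in> W +>\<^bsub>V\<^esub> x" using x W.a_rcos_self by simp
    then have "(SOME y. y \<in> W +>\<^bsub>V\<^esub> x) \<in> W +>\<^bsub>V\<^esub> x" by (rule someI)
    then obtain w where w: "w \<in> W" "(SOME y. y \<in> W +>\<^bsub>V\<^esub> x) = w \<oplus>\<^bsub>V\<^esub> x"
      by (auto simp: a_r_coset_def')
    then have "g (W +>\<^bsub>V\<^esub> x) = h w \<oplus>\<^bsub>P\<^esub> h x"
      using assms(2) x by (auto simp: g_def module_hom_add)
    then show ?thesis
      using assms(2,3) w x by (auto simp: module_hom_in_carrier)
  qed
  then show ?thesis
    using module_hom_in_carrier[OF assms(2)] module_hom_add[OF assms(2)]  module_hom_smult[OF assms(2)]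
    by (intro bexI[of _ g] module_homI) (auto simp: quotient_carrier quotient_add quotient_smult)
qed

end

section \<open>Tensor products\<close>

lemma (in module_quotient) coset_eq_minusI:
  assumes "x \<in> carrier V" "y \<in> carrier V" "x \<ominus>\<^bsub>V\<^esub> y \<in> W"
  shows "W +>\<^bsub>V\<^esub> x = W +>\<^bsub>V\<^esub> y"
proof -
  have "x = (x \<ominus>\<^bsub>V\<^esub> y) \<oplus>\<^bsub>V\<^esub> y"
    using assms(1,2) by (simp add: V.M.minus_eq V.M.a_assoc V.M.l_neg)
  then show ?thesis
    using coset_eqI[OF assms(2,3)] by simp
qed

lemma module_hom_restrict:
  assumes "module K M" "g \<in> module_hom K M N"
  shows "restrict g (carrier M) \<in> module_hom K M N"
proof -
  interpret M: module K M by fact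
  show ?thesis using assms(2) by (auto simp: module_hom_def)
qed

section \<open>Bilinear maps and the universal property of the tensor product\<close>

definition bilinear ::
  "('k, 'r) ring_scheme \<Rightarrow> ('k, 'm, 'x) module_scheme \<Rightarrow> ('k, 'n, 'y) module_scheme
    \<Rightarrow> ('k, 'p, 'z) module_scheme \<Rightarrow> ('m \<Rightarrow> 'n \<Rightarrow> 'p) \<Rightarrow> bool" where
  "bilinear K M N P \<beta> \<longleftrightarrow>
    (\<forall>m\<in>carrier M. (\<lambda>n. \<beta> m n) \<in> module_hom K N P) \<and>
    (\<forall>n\<in>carrier N. (\<lambda>m. \<beta> m n) \<in> module_hom K M P)"

lemma bilinearI:
  assumes "\<And>m n. \<lbrakk>m \<in> carrier M; n \<in> carrier N\<rbrakk> \<Longrightarrow> \<beta> m n \<in> carrier P"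
    and "\<And>m m' n. \<lbrakk>m \<in> carrier M; m' \<in> carrier M; n \<in> carrier N\<rbrakk> \<Longrightarrow>
      \<beta> (m \<oplus>\<^bsub>M\<^esub> m') n = \<beta> m n \<oplus>\<^bsub>P\<^esub> \<beta> m' n"
    and "\<And>m n n'. \<lbrakk>m \<in> carrier M; n \<in> carrier N; n' \<in> carrier N\<rbrakk> \<Longrightarrow>
      \<beta> m (n \<oplus>\<^bsub>N\<^esub> n') = \<beta> m n \<oplus>\<^bsub>P\<^esub> \<beta> m n'"
    and "\<And>a m n. \<lbrakk>a \<in> carrier K; m \<in> carrier M; n \<in> carrier N\<rbrakk> \<Longrightarrow>
      \<beta> (a \<odot>\<^bsub>M\<^esub> m) n = a \<odot>\<^bsub>P\<^esub> \<beta> m n"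
    and "\<And>a m n. \<lbrakk>a \<in> carrier K; m \<in> carrier M; n \<in> carrier N\<rbrakk> \<Longrightarrow>
      \<beta> m (a \<odot>\<^bsub>N\<^esub> n) = a \<odot>\<^bsub>P\<^esub> \<beta> m n"
  shows "bilinear K M N P \<beta>"
  using assms by (simp add: bilinear_def module_hom_def)

lemma bilinear_closed:
  "\<lbrakk>bilinear K M N P \<beta>; m \<in> carrier M; n \<in> carrier N\<rbrakk> \<Longrightarrow> \<beta> m n \<in> carrier P"
  and bilinear_add_left:
  "\<lbrakk>bilinear K M N P \<beta>; m \<in> carrier M; m' \<in> carrier M; n \<in> carrier N\<rbrakk> \<Longrightarrow>
    \<beta> (m \<oplus>\<^bsub>M\<^esub> m') n = \<beta> m n \<oplus>\<^bsub>P\<^esub> \<beta> m' n"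
  and bilinear_add_right:
  "\<lbrakk>bilinear K M N P \<beta>; m \<in> carrier M; n \<in> carrier N; n' \<in> carrier N\<rbrakk> \<Longrightarrow>
    \<beta> m (n \<oplus>\<^bsub>N\<^esub> n') = \<beta> m n \<oplus>\<^bsub>P\<^esub> \<beta> m n'"
  and bilinear_smult_left:
  "\<lbrakk>bilinear K M N P \<beta>; a \<in> carrier K; m \<in> carrier M; n \<in> carrier N\<rbrakk> \<Longrightarrow>
    \<beta> (a \<odot>\<^bsub>M\<^esub> m) n = a \<odot>\<^bsub>P\<^esub> \<beta> m n"
  and bilinear_smult_right:
  "\<lbrakk>bilinear K M N P \<beta>; a \<in> carrier K; m \<in> carrier M; n \<in> carrier N\<rbrakk> \<Longrightarrow>
    \<beta> m (a \<odot>\<^bsub>N\<^esub> n) = a \<odot>\<^bsub>P\<^esub> \<beta> m n"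
  by (simp_all add: bilinear_def module_hom_def Pi_iff)

definition tsum ::
  "('k, 'r) ring_scheme \<Rightarrow> ('k, 'm, 'x) module_scheme \<Rightarrow> ('k, 'n, 'y) module_scheme
    \<Rightarrow> ('m \<times> 'n) list \<Rightarrow> ('m \<times> 'n \<Rightarrow> 'k) set" where
  "tsum K M N xs = lsum (tensor K M N) (\<lambda>(m, n). pure_tensor K M N m n) xs"

lemma tsum_Nil [simp]: "tsum K M N [] = \<zero>\<^bsub>tensor K M N\<^esub>"
  and tsum_Cons [simp]: "tsum K M N ((m, n) # xs) = pure_tensor K M N m n \<oplus>\<^bsub>tensor K M N\<^esub> tsum K M N xs"
  by (simp_all add: tsum_def)

text \<open>No bilinearity is required: the definite description itself consults \<beta> only on the
  two carriers.\<close>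

lemma tensor_lift_cong:
  "(\<And>m n. \<lbrakk>m \<in> carrier M; n \<in> carrier N\<rbrakk> \<Longrightarrow> \<beta> m n = \<gamma> m n) \<Longrightarrow>
    tensor_lift K M N P \<beta> = tensor_lift K M N P \<gamma>"
  unfolding tensor_lift_def by (simp cong: ball_cong)

text \<open>Only the module axioms are assumed, so that a tensor product can itself be a factor via
  \<open>module_tensor\<close>. Where functionals have to separate points,
  \<open>vectorspace K N\<close> is added as a hypothesis.\<close>

locale two_modules = M?: module K M + N?: module K N
  for K :: "('k, 'r) ring_scheme" and M :: "('k, 'm, 'x) module_scheme"
    and N :: "('k, 'n, 'y) module_scheme"
begin

abbreviation (input) F where "F \<equiv> free_module K (carrier M \<times> carrier N)"
abbreviation (input) T where "T \<equiv> tensor K M N"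
abbreviation (input) pt where "pt \<equiv> pure_tensor K M N"

lemma module_F: "module K F"
  by (rule module_free_module)

lemma gen_in_F: "\<lbrakk>m \<in> carrier M; n \<in> carrier N\<rbrakk> \<Longrightarrow> free_gen K (m, n) \<in> carrier F"
  by (rule free_gen_in_carrier) simp

lemma relations_in_F: "tensor_relations K M N \<subseteq> carrier F"
proof -
  interpret F: module K F by (rule module_F)
  have "r \<in> carrier F" if "r \<in> tensor_relations K M N" for r
    using that unfolding tensor_relations_def Let_def
    by (elim UnE CollectE exE conjE)
      (erule ssubst, (rule F.M.minus_closed F.M.a_closed F.smult_closed gen_in_F
          M.M.a_closed M.smult_closed N.M.a_closed N.smult_closed | assumption)+)+
  then show ?thesis by blast
qed

lemma module_quotient_tensor_kernel: "module_quotient K F (tensor_kernel K M N)"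
  unfolding tensor_kernel_def module_quotient_def module_quotient_axioms_def
  using module_F module.span_is_submodule relations_in_F by blast

lemma module_tensor: "module K T"
  unfolding tensor_def by (rule module_quotient.module_quotient_module[OF module_quotient_tensor_kernel])

lemma pure_tensor_closed: "\<lbrakk>m \<in> carrier M; n \<in> carrier N\<rbrakk> \<Longrightarrow> pt m n \<in> carrier T"
  unfolding tensor_def pure_tensor_def module_quotient.quotient_carrier[OF module_quotient_tensor_kernel]
  using gen_in_F by blast

lemma
  assumes "m \<in> carrier M" "n \<in> carrier N"
  shows relation_add_left: "m' \<in> carrier M \<Longrightarrow>
      free_gen K (m \<oplus>\<^bsub>M\<^esub> m', n) \<ominus>\<^bsub>F\<^esub> (free_gen K (m, n) \<oplus>\<^bsub>F\<^esub> free_gen K (m', n)) \<in> tensor_kernel K M N"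
    and relation_add_right: "n' \<in> carrier N \<Longrightarrow>
      free_gen K (m, n \<oplus>\<^bsub>N\<^esub> n') \<ominus>\<^bsub>F\<^esub> (free_gen K (m, n) \<oplus>\<^bsub>F\<^esub> free_gen K (m, n')) \<in> tensor_kernel K M N"
    and relation_smult_left: "a \<in> carrier K \<Longrightarrow>
      free_gen K (a \<odot>\<^bsub>M\<^esub> m, n) \<ominus>\<^bsub>F\<^esub> a \<odot>\<^bsub>F\<^esub> free_gen K (m, n) \<in> tensor_kernel K M N"
    and relation_smult_right: "a \<in> carrier K \<Longrightarrow>
      free_gen K (m, a \<odot>\<^bsub>N\<^esub> n) \<ominus>\<^bsub>F\<^esub> a \<odot>\<^bsub>F\<^esub> free_gen K (m, n) \<in> tensor_kernel K M N"
  unfolding tensor_kernel_def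
  subgoal
    apply (rule subsetD[OF module.in_own_span[OF module_F relations_in_F]])
    unfolding tensor_relations_def Let_def by (rule UnI1, rule UnI1, rule UnI1, insert assms) blast
  subgoal
    apply (rule subsetD[OF module.in_own_span[OF module_F relations_in_F]])
    unfolding tensor_relations_def Let_def by (rule UnI1, rule UnI1, rule UnI2, insert assms) blast
  subgoal
    apply (rule subsetD[OF module.in_own_span[OF module_F relations_in_F]])
    unfolding tensor_relations_def Let_def by (rule UnI1, rule UnI2, insert assms) blast
  subgoal
    apply (rule subsetD[OF module.in_own_span[OF module_F relations_in_F]])
    unfolding tensor_relations_def Let_def by (rule UnI2, insert assms) blast
  done

lemma pure_tensor_bilinear: "bilinear K M N T pt"
proof -
  interpret F: module K F by (rule module_F)
  interpret Q: module_quotient K F "tensor_kernel K M N" by (rule module_quotient_tensor_kernel)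
  have 1: "pt (m \<oplus>\<^bsub>M\<^esub> m') n = pt m n \<oplus>\<^bsub>T\<^esub> pt m' n"
    if "m \<in> carrier M" "m' \<in> carrier M" "n \<in> carrier N" for m m' n
  proof -
    have "free_gen K (m \<oplus>\<^bsub>M\<^esub> m', n) \<ominus>\<^bsub>F\<^esub> (free_gen K (m, n) \<oplus>\<^bsub>F\<^esub> free_gen K (m', n))
        \<in> tensor_kernel K M N"
      using relation_add_left that by blast
    then have "pt (m \<oplus>\<^bsub>M\<^esub> m') n = tensor_kernel K M N +>\<^bsub>F\<^esub> (free_gen K (m, n) \<oplus>\<^bsub>F\<^esub> free_gen K (m', n))"
      unfolding pure_tensor_def using that
      by (intro Q.coset_eq_minusI F.M.add.m_closed) (auto simp: gen_in_F)
    then show ?thesis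
      using that by (simp add: pure_tensor_def tensor_def Q.quotient_add gen_in_F del: free_module_simps)
  qed
  have 2: "pt m (n \<oplus>\<^bsub>N\<^esub> n') = pt m n \<oplus>\<^bsub>T\<^esub> pt m n'"
    if "m \<in> carrier M" "n \<in> carrier N" "n' \<in> carrier N" for m n n'
  proof -
    have "free_gen K (m, n \<oplus>\<^bsub>N\<^esub> n') \<ominus>\<^bsub>F\<^esub> (free_gen K (m, n) \<oplus>\<^bsub>F\<^esub> free_gen K (m, n'))
        \<in> tensor_kernel K M N"
      using relation_add_right that by blast
    then have "pt m (n \<oplus>\<^bsub>N\<^esub> n') = tensor_kernel K M N +>\<^bsub>F\<^esub> (free_gen K (m, n) \<oplus>\<^bsub>F\<^esub> free_gen K (m, n'))"
      unfolding pure_tensor_def using that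
      by (intro Q.coset_eq_minusI F.M.add.m_closed) (auto simp: gen_in_F)
    then show ?thesis
      using that by (simp add: pure_tensor_def tensor_def Q.quotient_add gen_in_F del: free_module_simps)
  qed
  have 3: "pt (a \<odot>\<^bsub>M\<^esub> m) n = a \<odot>\<^bsub>T\<^esub> pt m n"
    if "m \<in> carrier M" "a \<in> carrier K" "n \<in> carrier N" for m a n
  proof -
    have "free_gen K (a \<odot>\<^bsub>M\<^esub> m, n) \<ominus>\<^bsub>F\<^esub> a \<odot>\<^bsub>F\<^esub> free_gen K (m, n) \<in> tensor_kernel K M N"
      using relation_smult_left that by blast
    then have "pt (a \<odot>\<^bsub>M\<^esub> m) n = tensor_kernel K M N +>\<^bsub>F\<^esub> (a \<odot>\<^bsub>F\<^esub> free_gen K (m, n))"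
      unfolding pure_tensor_def using that
      by (intro Q.coset_eq_minusI F.smult_closed) (auto simp: gen_in_F)
    then show ?thesis
      using that by (simp add: pure_tensor_def tensor_def Q.quotient_smult gen_in_F del: free_module_simps)
  qed
  have 4: "pt m (a \<odot>\<^bsub>N\<^esub> n) = a \<odot>\<^bsub>T\<^esub> pt m n"
    if "m \<in> carrier M" "a \<in> carrier K" "n \<in> carrier N" for m a n
  proof -
    have "free_gen K (m, a \<odot>\<^bsub>N\<^esub> n) \<ominus>\<^bsub>F\<^esub> a \<odot>\<^bsub>F\<^esub> free_gen K (m, n) \<in> tensor_kernel K M N"
      using relation_smult_right that by blast
    then have "pt m (a \<odot>\<^bsub>N\<^esub> n) = tensor_kernel K M N +>\<^bsub>F\<^esub> (a \<odot>\<^bsub>F\<^esub> free_gen K (m, n))"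
      unfolding pure_tensor_def using that
      by (intro Q.coset_eq_minusI F.smult_closed) (auto simp: gen_in_F)
    then show ?thesis
      using that by (simp add: pure_tensor_def tensor_def Q.quotient_smult gen_in_F del: free_module_simps)
  qed
  show ?thesis
    by (intro bilinearI pure_tensor_closed 1 2 3 4)
qed

text \<open>A list of pairs without coefficients suffices, because a scalar in front of a generator
  can be absorbed into its left factor.\<close>

lemma tensor_repr:
  assumes "t \<in> carrier T"
  obtains xs where "set xs \<subseteq> carrier M \<times> carrier N" "t = tsum K M N xs"
proof -
  interpret F: module K F by (rule module_F)
  interpret Q: module_quotient K F "tensor_kernel K M N" by (rule module_quotient_tensor_kernel)
  have pt_smult: "pt (a \<odot>\<^bsub>M\<^esub> m) n = a \<odot>\<^bsub>T\<^esub> pt m n"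
    if "m \<in> carrier M" "a \<in> carrier K" "n \<in> carrier N" for m a n
    using that by (intro bilinear_smult_left[OF pure_tensor_bilinear])
  obtain f where f: "f \<in> carrier F" "t = tensor_kernel K M N +>\<^bsub>F\<^esub> f"
    using assms unfolding tensor_def by (auto simp: Q.quotient_carrier)
  have "\<exists>xs. set xs \<subseteq> carrier M \<times> carrier N \<and> tensor_kernel K M N +>\<^bsub>F\<^esub> f = tsum K M N xs"
    using f(1)
  proof (induction f rule: M.R.free_module_induct)
    case zero
    show ?case
      by (rule exI[of _ "[]"]) (simp add: tensor_def Q.quotient_zero del: free_module_simps)
  next
    case (add a x g)
    obtain m n where x: "x = (m, n)" "m \<in> carrier M" "n \<in> carrier N" using add(2) by auto
    obtain xs where xs: "set xs \<subseteq> carrier M \<times> carrier N" "tensor_kernel K M N +>\<^bsub>F\<^esub> g = tsum K M N xs"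
      using add(4) by auto
    have "tensor_kernel K M N +>\<^bsub>F\<^esub> ((a \<odot>\<^bsub>F\<^esub> free_gen K x) \<oplus>\<^bsub>F\<^esub> g)
      = pt (a \<odot>\<^bsub>M\<^esub> m) n \<oplus>\<^bsub>T\<^esub> tsum K M N xs"
    proof -
      have ax: "a \<odot>\<^bsub>F\<^esub> free_gen K x \<in> carrier F"
        using add(1) gen_in_F[OF x(2,3)] x(1) by (intro F.smult_closed) auto
      show ?thesis
        unfolding xs(2)[symmetric] pt_smult[OF x(2) add(1) x(3)] unfolding pure_tensor_def tensor_def
        unfolding Q.quotient_add[OF ax add(3), symmetric]
        unfolding x(1) Q.quotient_smult[OF add(1) gen_in_F[OF x(2,3)]] ..
    qed
    then show ?case
      using xs x add by (intro exI[of _ "(a \<odot>\<^bsub>M\<^esub> m, n) # xs"]) auto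
  qed
  then show ?thesis using that f(2) by auto
qed

lemma tsum_closed: "set xs \<subseteq> carrier M \<times> carrier N \<Longrightarrow> tsum K M N xs \<in> carrier T"
  unfolding tsum_def by (intro abelian_monoid.lsum_closed abelian_group.axioms module.axioms(2)[OF module_tensor]) (auto simp: pure_tensor_closed)

lemma hom_tsum:
  assumes "module K P" "h \<in> module_hom K T P" "set xs \<subseteq> carrier M \<times> carrier N"
  shows "h (tsum K M N xs) = lsum P (\<lambda>(m, n). h (pt m n)) xs"
  unfolding tsum_def using assms(3)
  by (subst lsum_hom[OF module_tensor assms(1,2)])
    (auto simp: pure_tensor_closed intro!: lsum_cong)

lemma tensor_hom_eqI:
  assumes "module K P" "g \<in> module_hom K T P" "h \<in> module_hom K T P"
    and "\<And>m n. \<lbrakk>m \<in> carrier M; n \<in> carrier N\<rbrakk> \<Longrightarrow> g (pt m n) = h (pt m n)"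
    and "t \<in> carrier T"
  shows "g t = h t"
proof -
  obtain xs where xs: "set xs \<subseteq> carrier M \<times> carrier N" "t = tsum K M N xs"
    using tensor_repr[OF assms(5)] .
  then show ?thesis
    using assms(4) by (auto simp: hom_tsum[OF assms(1,2)] hom_tsum[OF assms(1,3)] intro!: lsum_cong)
qed

text \<open>Extend \<beta> linearly to the free module. The extension kills every defining relation
  by bilinearity, hence their span, since its kernel is a submodule; so it descends to the
  quotient.\<close>

lemma tensor_lift_exists:
  assumes "module K P" and \<beta>: "bilinear K M N P \<beta>"
  shows "\<exists>g\<in>module_hom K T P. \<forall>m\<in>carrier M. \<forall>n\<in>carrier N. g (pt m n) = \<beta> m n"
proof -
  interpret F: module K F by (rule module_F)
  interpret Q: module_quotient K F "tensor_kernel K M N" by (rule module_quotient_tensor_kernel)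
  interpret P: module K P by fact
  have \<beta>_closed: "\<beta> m n \<in> carrier P" if "m \<in> carrier M" "n \<in> carrier N" for m n
    using \<beta> that by (rule bilinear_closed)
  have "\<exists>h\<in>module_hom K F P. \<forall>x\<in>carrier M \<times> carrier N. h (free_gen K x) = case_prod \<beta> x"
    by (rule M.R.free_module_lift) (use assms \<beta>_closed in auto)
  then obtain h where h: "h \<in> module_hom K F P"
    and h_gen: "\<And>m n. \<lbrakk>m \<in> carrier M; n \<in> carrier N\<rbrakk> \<Longrightarrow> h (free_gen K (m, n)) = \<beta> m n"
    by auto
  interpret h: mod_hom K F P h
    by unfold_locales (rule h)
  have h_add: "h (x \<oplus>\<^bsub>F\<^esub> y) = h x \<oplus>\<^bsub>P\<^esub> h y" if "x \<in> carrier F" "y \<in> carrier F" for x y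
    using module_hom_add[OF h that] .
  have h_smult: "h (a \<odot>\<^bsub>F\<^esub> y) = a \<odot>\<^bsub>P\<^esub> h y" if "a \<in> carrier K" "y \<in> carrier F" for a y
    using module_hom_smult[OF h that] .
  \<comment> \<open>Each relation is a difference of two terms, so it is enough that h takes equal
    values on them.\<close>
  have h_minus: "h (x \<ominus>\<^bsub>F\<^esub> y) = \<zero>\<^bsub>P\<^esub>" if "x \<in> carrier F" "y \<in> carrier F" "h x = h y" for x y
    using that h.f_minus[OF that(1,2)] by (simp add: P.M.r_neg P.M.minus_eq)
  have F_closed: "x \<oplus>\<^bsub>F\<^esub> y \<in> carrier F" "a \<odot>\<^bsub>F\<^esub> x \<in> carrier F"
    if "x \<in> carrier F" "y \<in> carrier F" "a \<in> carrier K" for x y a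
    using that F.M.add.m_closed F.smult_closed by blast+
  have "h r = \<zero>\<^bsub>P\<^esub>" if "r \<in> tensor_relations K M N" for r
    using that unfolding tensor_relations_def Let_def
    by (elim UnE CollectE exE conjE; hypsubst; intro h_minus)
      (simp_all add: h_add h_smult h_gen gen_in_F F_closed bilinear_add_left[OF \<beta>]
        bilinear_add_right[OF \<beta>] bilinear_smult_left[OF \<beta>] bilinear_smult_right[OF \<beta>]
        del: free_module_simps)
  then have "tensor_relations K M N \<subseteq> h.ker"
    using relations_in_F by (auto simp: h.ker_def)
  then have "tensor_kernel K M N \<subseteq> h.ker"
    unfolding tensor_kernel_def by (rule F.span_is_subset[OF _ h.ker_is_submodule])
  then have "\<exists>g\<in>module_hom K T P. \<forall>x\<in>carrier F. g (tensor_kernel K M N +>\<^bsub>F\<^esub> x) = h x"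
    unfolding tensor_def by (intro Q.quotient_lift[OF assms(1) h]) (auto simp: h.ker_def)
  then obtain g where g: "g \<in> module_hom K T P"
    and "\<And>x. x \<in> carrier F \<Longrightarrow> g (tensor_kernel K M N +>\<^bsub>F\<^esub> x) = h x" by blast
  then have "g (pt m n) = \<beta> m n" if "m \<in> carrier M" "n \<in> carrier N" for m n
    using that unfolding pure_tensor_def by (simp only: h_gen gen_in_F)
  with g show ?thesis by blast
qed

text \<open>What makes the definite description \<open>tensor_lift\<close> usable. Existence is the
  universal property, cut down to the carrier to meet the \<open>extensional\<close> condition;
  uniqueness holds because pure tensors generate.\<close>

lemma
  assumes "module K P" and \<beta>: "bilinear K M N P \<beta>"
  shows tensor_lift_hom: "tensor_lift K M N P \<beta> \<in> module_hom K T P"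
    and tensor_lift_pure: "\<lbrakk>m \<in> carrier M; n \<in> carrier N\<rbrakk> \<Longrightarrow> tensor_lift K M N P \<beta> (pt m n) = \<beta> m n"
proof -
  obtain g where g: "g \<in> module_hom K T P"
    and g_pt: "\<And>m n. \<lbrakk>m \<in> carrier M; n \<in> carrier N\<rbrakk> \<Longrightarrow> g (pt m n) = \<beta> m n"
    using tensor_lift_exists[OF assms] by auto
  have "\<exists>!f. f \<in> module_hom K T P \<inter> extensional (carrier T) \<and>
      (\<forall>m\<in>carrier M. \<forall>n\<in>carrier N. f (pt m n) = \<beta> m n)"
  proof (rule ex1I[of _ "restrict g (carrier T)"])
    have "restrict g (carrier T) \<in> module_hom K T P"
      using g by (rule module_hom_restrict[OF module_tensor])
    then show "restrict g (carrier T) \<in> module_hom K T P \<inter> extensional (carrier T) \<and>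
      (\<forall>m\<in>carrier M. \<forall>n\<in>carrier N. restrict g (carrier T) (pt m n) = \<beta> m n)"
      by (auto simp: g_pt pure_tensor_closed)
  next
    fix f assume f: "f \<in> module_hom K T P \<inter> extensional (carrier T) \<and>
      (\<forall>m\<in>carrier M. \<forall>n\<in>carrier N. f (pt m n) = \<beta> m n)"
    show "f = restrict g (carrier T)"
    proof (rule extensionalityI[of _ "carrier T"])
      fix t assume "t \<in> carrier T"
      have "f t = g t"
        by (rule tensor_hom_eqI[OF assms(1) _ g _ \<open>t \<in> carrier T\<close>]) (use f g_pt in blast, metis f g_pt)
      then show "f t = restrict g (carrier T) t" using \<open>t \<in> carrier T\<close> by simp
    qed (use f in blast, simp)
  qed
  from theI'[OF this] have lift: "tensor_lift K M N P \<beta> \<in> module_hom K T P \<inter> extensional (carrier T) \<and>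
      (\<forall>m\<in>carrier M. \<forall>n\<in>carrier N. tensor_lift K M N P \<beta> (pt m n) = \<beta> m n)"
    unfolding tensor_lift_def .
  show "tensor_lift K M N P \<beta> \<in> module_hom K T P"
    using lift by (elim conjE IntE)
  show "tensor_lift K M N P \<beta> (pt m n) = \<beta> m n" if "m \<in> carrier M" "n \<in> carrier N"
    by (rule bspec[OF bspec[OF conjunct2[OF lift] that(1)] that(2)])
qed

lemma tensor_lift_tsum:
  assumes "module K P" "bilinear K M N P \<beta>" "set xs \<subseteq> carrier M \<times> carrier N"
  shows "tensor_lift K M N P \<beta> (tsum K M N xs) = lsum P (\<lambda>(m, n). \<beta> m n) xs"
  using assms(3) by (subst hom_tsum[OF assms(1) tensor_lift_hom[OF assms(1,2)]])
    (auto intro!: lsum_cong simp: tensor_lift_pure[OF assms(1,2)])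

end

section \<open>Complements, projections and functionals\<close>

lemma submoduleD:
  assumes "submodule K W V"
  shows "w \<in> W \<Longrightarrow> w \<in> carrier V" "\<lbrakk>v \<in> W; w \<in> W\<rbrakk> \<Longrightarrow> v \<oplus>\<^bsub>V\<^esub> w \<in> W" "\<zero>\<^bsub>V\<^esub> \<in> W"
    "\<lbrakk>a \<in> carrier K; w \<in> W\<rbrakk> \<Longrightarrow> a \<odot>\<^bsub>V\<^esub> w \<in> W"
  using assms by (auto simp: submodule_def)

lemma (in module) submodule_minus:
  assumes "submodule R W M" "v \<in> W" "w \<in> W"
  shows "v \<ominus>\<^bsub>M\<^esub> w \<in> W"
proof -
  have "(\<ominus> \<one>) \<odot>\<^bsub>M\<^esub> w \<in> W"
    using assms by (intro submoduleD) auto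
  then have "\<ominus>\<^bsub>M\<^esub> w \<in> W"
    using submoduleD(1)[OF assms(1,3)] by (simp add: smult_l_minus)
  then show ?thesis
    using assms by (simp add: M.minus_eq submoduleD)
qed

lemma (in module) submodule_add_line:
  assumes U: "submodule R U M" and x: "x \<in> carrier M"
  shows "submodule R {u \<oplus>\<^bsub>M\<^esub> a \<odot>\<^bsub>M\<^esub> x | u a. u \<in> U \<and> a \<in> carrier R} M" (is "submodule R ?S M")
proof (rule submodule.intro)
  note [simp] = submoduleD[OF U]
  show "module R M" ..
  show "?S \<subseteq> carrier M" using x by auto
  show "\<zero>\<^bsub>M\<^esub> \<in> ?S" using x by (auto intro!: exI[of _ "\<zero>\<^bsub>M\<^esub>"] exI[of _ "\<zero>"])
next
  note [simp] = submoduleD[OF U]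
  fix v w assume "v \<in> ?S" "w \<in> ?S"
  then obtain u a u' a' where *: "u \<in> U" "a \<in> carrier R" "u' \<in> U" "a' \<in> carrier R"
    "v = u \<oplus>\<^bsub>M\<^esub> a \<odot>\<^bsub>M\<^esub> x" "w = u' \<oplus>\<^bsub>M\<^esub> a' \<odot>\<^bsub>M\<^esub> x" by auto
  then have "v \<oplus>\<^bsub>M\<^esub> w = (u \<oplus>\<^bsub>M\<^esub> u') \<oplus>\<^bsub>M\<^esub> (a \<oplus> a') \<odot>\<^bsub>M\<^esub> x"
    using x by (simp add: smult_l_distr M.a_ac)
  with * show "v \<oplus>\<^bsub>M\<^esub> w \<in> ?S"
    by (intro CollectI exI[of _ "u \<oplus>\<^bsub>M\<^esub> u'"] exI[of _ "a \<oplus> a'"]) auto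
next
  note [simp] = submoduleD[OF U]
  fix c v assume c: "c \<in> carrier R" and "v \<in> ?S"
  then obtain u a where *: "u \<in> U" "a \<in> carrier R" "v = u \<oplus>\<^bsub>M\<^esub> a \<odot>\<^bsub>M\<^esub> x" by auto
  then have "c \<odot>\<^bsub>M\<^esub> v = (c \<odot>\<^bsub>M\<^esub> u) \<oplus>\<^bsub>M\<^esub> (c \<otimes> a) \<odot>\<^bsub>M\<^esub> x"
    using x c by (simp add: smult_r_distr smult_assoc1)
  with * c show "c \<odot>\<^bsub>M\<^esub> v \<in> ?S"
    by (intro CollectI exI[of _ "c \<odot>\<^bsub>M\<^esub> u"] exI[of _ "c \<otimes> a"]) auto
qed

lemma submodule_chain_Union:
  assumes "\<C> \<noteq> {}" "subset.chain {U. submodule K U V} \<C>"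
  shows "submodule K (\<Union>\<C>) V"
proof (rule submodule.intro)
  have sub: "submodule K U V" if "U \<in> \<C>" for U
    using assms(2) that by (auto simp: subset.chain_def)
  obtain U where "U \<in> \<C>" using assms(1) by blast
  show "module K V" using sub[OF \<open>U \<in> \<C>\<close>] by (simp add: submodule_def)
  show "\<zero>\<^bsub>V\<^esub> \<in> \<Union>\<C>" using submoduleD(3)[OF sub[OF \<open>U \<in> \<C>\<close>]] \<open>U \<in> \<C>\<close> by blast
  show "\<Union>\<C> \<subseteq> carrier V" using submoduleD(1)[OF sub] by blast
  show "c \<odot>\<^bsub>V\<^esub> v \<in> \<Union>\<C>" if "c \<in> carrier K" "v \<in> \<Union>\<C>" for c v
    using submoduleD(4)[OF sub] that by blast
  fix v w assume "v \<in> \<Union>\<C>" "w \<in> \<Union>\<C>"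
  then obtain X Y where "X \<in> \<C>" "Y \<in> \<C>" "v \<in> X" "w \<in> Y" by blast
  moreover have "X \<subseteq> Y \<or> Y \<subseteq> X"
    using assms(2) \<open>X \<in> \<C>\<close> \<open>Y \<in> \<C>\<close> by (auto simp: subset.chain_def)
  ultimately show "v \<oplus>\<^bsub>V\<^esub> w \<in> \<Union>\<C>"
    using submoduleD(2)[OF sub] by blast
qed

text \<open>Zorn's lemma for the subspaces that contain W and meet D trivially: a maximal one is a
  complement of D. Prescribing W allows a projection onto D that also kills W.\<close>

lemma (in vectorspace) complement_exists:
  assumes W: "submodule K W V" and D: "submodule K D V" and WD: "W \<inter> D = {\<zero>\<^bsub>V\<^esub>}"
  obtains U where "submodule K U V" "W \<subseteq> U" "U \<inter> D = {\<zero>\<^bsub>V\<^esub>}"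
    "\<And>x. x \<in> carrier V \<Longrightarrow> \<exists>u\<in>U. \<exists>d\<in>D. x = u \<oplus>\<^bsub>V\<^esub> d"
proof -
  define \<A> where "\<A> = {U. submodule K U V \<and> W \<subseteq> U \<and> U \<inter> D = {\<zero>\<^bsub>V\<^esub>}}"
  have "\<exists>U\<in>\<A>. \<forall>X\<in>\<A>. U \<subseteq> X \<longrightarrow> X = U"
  proof (rule subset_Zorn_nonempty)
    show "\<A> \<noteq> {}" using W WD by (auto simp: \<A>_def)
    fix \<C> assume \<C>: "\<C> \<noteq> {}" "subset.chain \<A> \<C>"
    then have "subset.chain {U. submodule K U V} \<C>"
      by (auto simp: subset.chain_def \<A>_def)
    then have "submodule K (\<Union>\<C>) V"
      using \<C>(1) by (rule submodule_chain_Union[rotated])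
    moreover have "\<C> \<subseteq> \<A>" using \<C>(2) by (auto simp: subset.chain_def)
    ultimately show "\<Union>\<C> \<in> \<A>"
      using \<C>(1) unfolding \<A>_def by blast
  qed
  then obtain U where "U \<in> \<A>" and max: "\<And>X. X \<in> \<A> \<Longrightarrow> U \<subseteq> X \<Longrightarrow> X = U" by blast
  then have U: "submodule K U V" "W \<subseteq> U" "U \<inter> D = {\<zero>\<^bsub>V\<^esub>}" by (auto simp: \<A>_def)
  note Us = submoduleD[OF U(1)] and Ds = submoduleD[OF D]
  have "\<exists>u\<in>U. \<exists>d\<in>D. x = u \<oplus>\<^bsub>V\<^esub> d" if x: "x \<in> carrier V" for x
  proof (rule ccontr)
    assume no: "\<not> (\<exists>u\<in>U. \<exists>d\<in>D. x = u \<oplus>\<^bsub>V\<^esub> d)"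
    define U' where "U' = {u \<oplus>\<^bsub>V\<^esub> a \<odot>\<^bsub>V\<^esub> x | u a. u \<in> U \<and> a \<in> carrier K}"
    have U': "submodule K U' V"
      unfolding U'_def by (rule submodule_add_line[OF U(1) x])
    have "u \<in> U'" if "u \<in> U" for u
      unfolding U'_def using that x Us by (intro CollectI exI[of _ u] exI[of _ "\<zero>\<^bsub>K\<^esub>"]) auto
    then have UU': "U \<subseteq> U'" by blast
    have "y = \<zero>\<^bsub>V\<^esub>" if "y \<in> U'" "y \<in> D" for y
    proof -
      obtain u a where u: "u \<in> U" "a \<in> carrier K" "y = u \<oplus>\<^bsub>V\<^esub> a \<odot>\<^bsub>V\<^esub> x"
        using \<open>y \<in> U'\<close> by (auto simp: U'_def)
      have ux: "u \<in> carrier V" "y \<in> carrier V" using u Us Ds that by auto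
      show ?thesis
      proof (cases "a = \<zero>\<^bsub>K\<^esub>")
        case True
        then have "y = u" using u x ux by simp
        then show ?thesis using u U(3) that by blast
      next
        case False
        then have inv: "inv\<^bsub>K\<^esub> a \<in> carrier K" "inv\<^bsub>K\<^esub> a \<otimes>\<^bsub>K\<^esub> a = \<one>\<^bsub>K\<^esub>"
          using u field_Units by auto
        \<comment> \<open>Dividing y = u + a x by a \<noteq> 0 writes x as an element of U plus an
          element of D, contrary to the choice of x. Hence adjoining the line through x creates no
          new intersection with D.\<close>
        have "a \<odot>\<^bsub>V\<^esub> x = (\<ominus>\<^bsub>V\<^esub> u) \<oplus>\<^bsub>V\<^esub> y"
          using u ux x by (simp add: M.r_neg1)
        then have "inv\<^bsub>K\<^esub> a \<odot>\<^bsub>V\<^esub> (a \<odot>\<^bsub>V\<^esub> x) = inv\<^bsub>K\<^esub> a \<odot>\<^bsub>V\<^esub> (\<ominus>\<^bsub>V\<^esub> u) \<oplus>\<^bsub>V\<^esub> inv\<^bsub>K\<^esub> a \<odot>\<^bsub>V\<^esub> y"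
          using inv ux by (simp add: smult_r_distr)
        then have "x = inv\<^bsub>K\<^esub> a \<odot>\<^bsub>V\<^esub> (\<ominus>\<^bsub>V\<^esub> u) \<oplus>\<^bsub>V\<^esub> inv\<^bsub>K\<^esub> a \<odot>\<^bsub>V\<^esub> y"
          using inv u x by (simp add: smult_assoc1[symmetric])
        moreover have "\<zero>\<^bsub>V\<^esub> \<ominus>\<^bsub>V\<^esub> u \<in> U" by (rule submodule_minus[OF U(1)]) (use u Us in auto)
        then have "\<ominus>\<^bsub>V\<^esub> u \<in> U" using ux by (simp add: M.minus_eq)
        ultimately show ?thesis using no inv that Us(4) Ds(4) by blast
      qed
    qed
    then have "U' \<in> \<A>"
      using U' UU' U(2) Ds(3) submoduleD(3)[OF U'] unfolding \<A>_def by blast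
    then have "U' = U" using max UU' by blast
    moreover have "\<zero>\<^bsub>V\<^esub> \<oplus>\<^bsub>V\<^esub> \<one>\<^bsub>K\<^esub> \<odot>\<^bsub>V\<^esub> x \<in> U'"
      unfolding U'_def using Us(3) by blast
    ultimately have "x \<in> U" using x by simp
    then have "x = x \<oplus>\<^bsub>V\<^esub> \<zero>\<^bsub>V\<^esub>" "x \<in> U" using x by simp_all
    then show False using no Ds(3) by blast
  qed
  then show ?thesis using that U by blast
qed

text \<open>The projection along a complement U \<supseteq> W. It is linear because the D-component
  in a decomposition along U and D is unique.\<close>

lemma (in vectorspace) projection_exists:
  assumes W: "submodule K W V" and D: "submodule K D V" and WD: "W \<inter> D = {\<zero>\<^bsub>V\<^esub>}"
  obtains p where "p \<in> module_hom K V (V\<lparr>carrier := D\<rparr>)" "\<And>d. d \<in> D \<Longrightarrow> p d = d"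
    "\<And>w. w \<in> W \<Longrightarrow> p w = \<zero>\<^bsub>V\<^esub>"
proof -
  obtain U where U: "submodule K U V" "W \<subseteq> U" "U \<inter> D = {\<zero>\<^bsub>V\<^esub>}"
    and sum: "\<And>x. x \<in> carrier V \<Longrightarrow> \<exists>u\<in>U. \<exists>d\<in>D. x = u \<oplus>\<^bsub>V\<^esub> d"
    using complement_exists[OF assms] by blast
  note Us = submoduleD[OF U(1)] and Ds = submoduleD[OF D]
  have uniq: "d = d'" if "u \<oplus>\<^bsub>V\<^esub> d = u' \<oplus>\<^bsub>V\<^esub> d'" "u \<in> U" "u' \<in> U" "d \<in> D" "d' \<in> D" for u d u' d'
  proof -
    note c = Us(1)[OF that(2)] Us(1)[OF that(3)] Ds(1)[OF that(4)] Ds(1)[OF that(5)]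
    have "d \<ominus>\<^bsub>V\<^esub> d' = u' \<ominus>\<^bsub>V\<^esub> u"
    proof -
      have "d = \<ominus>\<^bsub>V\<^esub> u \<oplus>\<^bsub>V\<^esub> (u \<oplus>\<^bsub>V\<^esub> d)" using c by (simp add: M.r_neg1)
      also have "\<dots> = (u' \<ominus>\<^bsub>V\<^esub> u) \<oplus>\<^bsub>V\<^esub> d'" using c that(1) by (simp add: M.minus_eq M.a_ac)
      finally show ?thesis using c by (simp add: M.minus_eq M.a_assoc M.r_neg)
    qed
    moreover have "d \<ominus>\<^bsub>V\<^esub> d' \<in> D" "u' \<ominus>\<^bsub>V\<^esub> u \<in> U"
      using that by (auto intro!: submodule_minus U D)
    ultimately have "d \<ominus>\<^bsub>V\<^esub> d' = \<zero>\<^bsub>V\<^esub>" using U(3) by auto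
    then show ?thesis using c M.minus_equality[of d "\<ominus>\<^bsub>V\<^esub> d'"] by (simp add: M.minus_eq)
  qed
  define p where "p x = (THE d. d \<in> D \<and> (\<exists>u\<in>U. x = u \<oplus>\<^bsub>V\<^esub> d))" for x
  have p: "p (u \<oplus>\<^bsub>V\<^esub> d) = d" if "u \<in> U" "d \<in> D" for u d
    unfolding p_def using that uniq by (intro the_equality) blast+
  have p_in: "p x \<in> D" and p_dec: "\<exists>u\<in>U. x = u \<oplus>\<^bsub>V\<^esub> p x" if "x \<in> carrier V" for x
    using sum[OF that] p by auto
  show ?thesis
  proof (rule that[of p])
    show "p d = d" if "d \<in> D" for d
      using p[OF Us(3) that] Ds(1)[OF that] by simp
    show "p w = \<zero>\<^bsub>V\<^esub>" if "w \<in> W" for w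
      using p[of w "\<zero>\<^bsub>V\<^esub>"] that U(2) Ds(3) Us(1)[of w] by auto
    show "p \<in> module_hom K V (V\<lparr>carrier := D\<rparr>)"
    proof (rule module_homI)
      fix x assume x: "x \<in> carrier V"
      show "p x \<in> carrier (V\<lparr>carrier := D\<rparr>)" using p_in[OF x] by simp
      obtain u where u: "u \<in> U" "x = u \<oplus>\<^bsub>V\<^esub> p x" using p_dec[OF x] by blast
      note c = Us(1)[OF u(1)] Ds(1)[OF p_in[OF x]]
      { fix y assume y: "y \<in> carrier V"
        obtain v where v: "v \<in> U" "y = v \<oplus>\<^bsub>V\<^esub> p y" using p_dec[OF y] by blast
        note c' = Us(1)[OF v(1)] Ds(1)[OF p_in[OF y]]
        have "x \<oplus>\<^bsub>V\<^esub> y = (u \<oplus>\<^bsub>V\<^esub> v) \<oplus>\<^bsub>V\<^esub> (p x \<oplus>\<^bsub>V\<^esub> p y)"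
          by (subst u(2), subst v(2)) (use c c' in \<open>simp add: M.a_ac\<close>)
        then have "p (x \<oplus>\<^bsub>V\<^esub> y) = p x \<oplus>\<^bsub>V\<^esub> p y"
          using p[of "u \<oplus>\<^bsub>V\<^esub> v" "p x \<oplus>\<^bsub>V\<^esub> p y"] u v x y p_in Us(2) Ds(2) by simp
        then show "p (x \<oplus>\<^bsub>V\<^esub> y) = p x \<oplus>\<^bsub>V\<lparr>carrier := D\<rparr>\<^esub> p y" by simp }
      { fix a assume a: "a \<in> carrier K"
        have "a \<odot>\<^bsub>V\<^esub> x = a \<odot>\<^bsub>V\<^esub> u \<oplus>\<^bsub>V\<^esub> a \<odot>\<^bsub>V\<^esub> p x"
          by (subst u(2)) (use a c in \<open>simp add: smult_r_distr\<close>)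
        then have "p (a \<odot>\<^bsub>V\<^esub> x) = a \<odot>\<^bsub>V\<^esub> p x"
          using p[of "a \<odot>\<^bsub>V\<^esub> u" "a \<odot>\<^bsub>V\<^esub> p x"] u x a p_in Us(4) Ds(4) by simp
        then show "p (a \<odot>\<^bsub>V\<^esub> x) = a \<odot>\<^bsub>V\<lparr>carrier := D\<rparr>\<^esub> p x" by simp }
    qed
  qed
qed

lemma (in module) zero_submodule: "submodule R {\<zero>\<^bsub>M\<^esub>} M"
  by (rule submodule.intro) (auto intro: module_axioms)

text \<open>Project onto the line through v along a complement that contains W and read off the
  coordinate with respect to v.\<close>

lemma (in vectorspace) separating_functional:
  assumes W: "submodule K W V" and v: "v \<in> carrier V" "v \<notin> W"
  obtains f where "f \<in> module_hom K V (regular_module K)" "f v = \<one>\<^bsub>K\<^esub>"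
    "\<And>w. w \<in> W \<Longrightarrow> f w = \<zero>\<^bsub>K\<^esub>"
proof -
  note Ws = submoduleD[OF W]
  define L where "L = {\<zero>\<^bsub>V\<^esub> \<oplus>\<^bsub>V\<^esub> a \<odot>\<^bsub>V\<^esub> v | a. a \<in> carrier K}"
  have inv: "inv\<^bsub>K\<^esub> a \<in> carrier K" "inv\<^bsub>K\<^esub> a \<otimes>\<^bsub>K\<^esub> a = \<one>\<^bsub>K\<^esub>" if "a \<in> carrier K" "a \<noteq> \<zero>\<^bsub>K\<^esub>" for a
    using that field_Units by auto
  \<comment> \<open>This serves twice: it shows that W meets L trivially and, as zero lies in W,
    that the coordinate on L is unique.\<close>
  have in_W: "a = \<zero>\<^bsub>K\<^esub>" if "a \<odot>\<^bsub>V\<^esub> v \<in> W" "a \<in> carrier K" for a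
  proof (rule ccontr)
    assume a: "a \<noteq> \<zero>\<^bsub>K\<^esub>"
    have "inv\<^bsub>K\<^esub> a \<odot>\<^bsub>V\<^esub> (a \<odot>\<^bsub>V\<^esub> v) \<in> W" using that inv[OF that(2) a] Ws(4) by blast
    then have "v \<in> W" using inv[OF that(2) a] that(2) v by (simp add: smult_assoc1[symmetric])
    then show False using v by blast
  qed
  have L: "submodule K L V"
    using submodule_add_line[OF zero_submodule v(1)] by (simp add: L_def)
  have L_iff: "x \<in> L \<longleftrightarrow> (\<exists>a\<in>carrier K. x = a \<odot>\<^bsub>V\<^esub> v)" for x
  proof -
    have "\<zero>\<^bsub>V\<^esub> \<oplus>\<^bsub>V\<^esub> a \<odot>\<^bsub>V\<^esub> v = a \<odot>\<^bsub>V\<^esub> v" if "a \<in> carrier K" for a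
      using that v by simp
    then show ?thesis unfolding L_def by force
  qed
  have "W \<inter> L = {\<zero>\<^bsub>V\<^esub>}"
  proof -
    have "x = \<zero>\<^bsub>V\<^esub>" if "x \<in> W" "x \<in> L" for x
    proof -
      obtain a where a: "a \<in> carrier K" "x = a \<odot>\<^bsub>V\<^esub> v" using \<open>x \<in> L\<close> L_iff by blast
      then have "a = \<zero>\<^bsub>K\<^esub>" using \<open>x \<in> W\<close> in_W by blast
      then show ?thesis using a v by simp
    qed
    then show ?thesis using Ws(3) submoduleD(3)[OF L] by blast
  qed
  then obtain p where p: "p \<in> module_hom K V (V\<lparr>carrier := L\<rparr>)" "\<And>d. d \<in> L \<Longrightarrow> p d = d"
    "\<And>w. w \<in> W \<Longrightarrow> p w = \<zero>\<^bsub>V\<^esub>"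
    using projection_exists[OF W L] by blast
  have eq: "a = b" if "a \<odot>\<^bsub>V\<^esub> v = b \<odot>\<^bsub>V\<^esub> v" "a \<in> carrier K" "b \<in> carrier K" for a b
  proof -
    have "(a \<ominus>\<^bsub>K\<^esub> b) \<odot>\<^bsub>V\<^esub> v = \<zero>\<^bsub>V\<^esub>"
      using that v by (simp add: R.minus_eq smult_l_distr smult_l_minus M.r_neg)
    then have "a \<ominus>\<^bsub>K\<^esub> b = \<zero>\<^bsub>K\<^esub>" using that Ws(3) by (intro in_W) auto
    then show ?thesis using that by simp
  qed
  define f where "f x = (THE a. a \<in> carrier K \<and> p x = a \<odot>\<^bsub>V\<^esub> v)" for x
  have f: "f x = a" if "p x = a \<odot>\<^bsub>V\<^esub> v" "a \<in> carrier K" for x a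
    unfolding f_def using that eq by (intro the_equality) auto
  have f_in: "f x \<in> carrier K" and p_f: "p x = f x \<odot>\<^bsub>V\<^esub> v" if "x \<in> carrier V" for x
  proof -
    have "p x \<in> L" using module_hom_in_carrier[OF p(1) that] by simp
    then show "f x \<in> carrier K" "p x = f x \<odot>\<^bsub>V\<^esub> v" using f by (auto simp: L_iff)
  qed
  show ?thesis
  proof (rule that[of f])
    show "f v = \<one>\<^bsub>K\<^esub>"
    proof (rule f)
      have "v \<in> L" using v L_iff by (metis R.one_closed smult_one)
      then show "p v = \<one>\<^bsub>K\<^esub> \<odot>\<^bsub>V\<^esub> v" using v p(2) by simp
    qed simp
    show "f w = \<zero>\<^bsub>K\<^esub>" if "w \<in> W" for w
      using v p(3)[OF that] by (intro f) auto
    show "f \<in> module_hom K V (regular_module K)"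
      using v f_in p_f module_hom_add[OF p(1)] module_hom_smult[OF p(1)]
      by (intro module_homI) (auto intro!: f simp: smult_l_distr smult_assoc1)
  qed
qed

section \<open>Contractions\<close>

text \<open>The map id \<otimes> f followed by M \<otimes> K \<cong> M. The action of
  \<open>comodule_action\<close> and the right counit axiom both have this form.\<close>

definition contract ::
  "('k, 'r) ring_scheme \<Rightarrow> ('k, 'm, 'x) module_scheme \<Rightarrow> ('k, 'n, 'y) module_scheme
    \<Rightarrow> ('n \<Rightarrow> 'k) \<Rightarrow> ('m \<times> 'n \<Rightarrow> 'k) set \<Rightarrow> 'm" where
  "contract K M N f = tensor_lift K M N M (\<lambda>m n. f n \<odot>\<^bsub>M\<^esub> m)"

abbreviation functionals ::
  "('k, 'r) ring_scheme \<Rightarrow> ('k, 'n, 'y) module_scheme \<Rightarrow> ('n \<Rightarrow> 'k) set" where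
  "functionals K N \<equiv> module_hom K N (regular_module K)"

lemma functionalD:
  assumes "f \<in> functionals K N"
  shows "x \<in> carrier N \<Longrightarrow> f x \<in> carrier K"
    "\<lbrakk>x \<in> carrier N; y \<in> carrier N\<rbrakk> \<Longrightarrow> f (x \<oplus>\<^bsub>N\<^esub> y) = f x \<oplus>\<^bsub>K\<^esub> f y"
    "\<lbrakk>a \<in> carrier K; x \<in> carrier N\<rbrakk> \<Longrightarrow> f (a \<odot>\<^bsub>N\<^esub> x) = a \<otimes>\<^bsub>K\<^esub> f x"
  using module_hom_in_carrier[OF assms] module_hom_add[OF assms] module_hom_smult[OF assms] by simp_all

lemma contract_cong:
  "(\<And>n. n \<in> carrier N \<Longrightarrow> f n = g n) \<Longrightarrow> contract K M N f = contract K M N g"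
  unfolding contract_def by (rule tensor_lift_cong) simp

text \<open>The linear span, built one vector at a time so that membership unfolds along the list;
  this is the recursion that \<open>pure_add_tsum\<close> follows.\<close>

primrec lspan :: "('k, 'r) ring_scheme \<Rightarrow> ('k, 'n, 'y) module_scheme \<Rightarrow> 'n list \<Rightarrow> 'n set" where
  "lspan K N [] = {\<zero>\<^bsub>N\<^esub>}"
| "lspan K N (n # ns) = {w \<oplus>\<^bsub>N\<^esub> a \<odot>\<^bsub>N\<^esub> n | w a. w \<in> lspan K N ns \<and> a \<in> carrier K}"

lemma (in module) submodule_lspan:
  "set ns \<subseteq> carrier M \<Longrightarrow> submodule R (lspan R M ns) M"
  by (induction ns) (simp_all add: zero_submodule submodule_add_line)

lemma (in module) in_lspan:
  "\<lbrakk>set ns \<subseteq> carrier M; n \<in> set ns\<rbrakk> \<Longrightarrow> n \<in> lspan R M ns"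
proof (induction ns)
  case (Cons k ns)
  note S = submoduleD[OF submodule_lspan[of ns]]
  show ?case
  proof (cases "n = k")
    case True
    then show ?thesis
      unfolding lspan.simps using S(3) Cons.prems
      by (intro CollectI exI[of _ "\<zero>\<^bsub>M\<^esub>"] exI[of _ "\<one>"] conjI) auto
  next
    case False
    then have n: "n \<in> lspan R M ns" using Cons by simp
    then show ?thesis
      unfolding lspan.simps using Cons.prems
      by (intro CollectI exI[of _ n] exI[of _ "\<zero>"] conjI) auto
  qed
qed simp

context two_modules
begin

lemma contract_bilinear:
  assumes "f \<in> functionals K N"
  shows "bilinear K M N M (\<lambda>m n. f n \<odot>\<^bsub>M\<^esub> m)"
  using functionalD[OF assms]
  by (intro bilinearI) (simp_all add: M.smult_l_distr M.smult_r_distr M.smult_assoc1[symmetric] M.R.m_comm)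

lemma contract_hom: "f \<in> functionals K N \<Longrightarrow> contract K M N f \<in> module_hom K T M"
  unfolding contract_def by (intro tensor_lift_hom contract_bilinear M.module_axioms)

lemma contract_pure:
  "\<lbrakk>f \<in> functionals K N; m \<in> carrier M; n \<in> carrier N\<rbrakk> \<Longrightarrow> contract K M N f (pt m n) = f n \<odot>\<^bsub>M\<^esub> m"
  unfolding contract_def by (intro tensor_lift_pure contract_bilinear M.module_axioms)

lemma contract_tsum:
  "\<lbrakk>f \<in> functionals K N; set xs \<subseteq> carrier M \<times> carrier N\<rbrakk> \<Longrightarrow>
    contract K M N f (tsum K M N xs) = lsum M (\<lambda>(m, n). f n \<odot>\<^bsub>M\<^esub> m) xs"
  unfolding contract_def by (intro tensor_lift_tsum contract_bilinear M.module_axioms)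

text \<open>If n is a combination of the right factors already present, m \<otimes> n splits into
  pieces, each of which merges with a term having the same right factor. The number of terms
  therefore does not grow, and this is what drives the induction in
  \<open>contract_eq_zeroD\<close>.\<close>

lemma pure_add_tsum:
  assumes "set xs \<subseteq> carrier M \<times> carrier N" "m \<in> carrier M" "n \<in> lspan K N (map snd xs)"
  shows "\<exists>ys. length ys = length xs \<and> set ys \<subseteq> carrier M \<times> carrier N \<and>
    pt m n \<oplus>\<^bsub>T\<^esub> tsum K M N xs = tsum K M N ys"
  using assms
proof (induction xs arbitrary: n)
  case Nil
  interpret T: module K T by (rule module_tensor)
  have "pt m \<zero>\<^bsub>N\<^esub> = pt m (\<zero>\<^bsub>K\<^esub> \<odot>\<^bsub>N\<^esub> \<zero>\<^bsub>N\<^esub>)" by simp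
  also have "\<dots> = \<zero>\<^bsub>T\<^esub>"
    using Nil by (subst bilinear_smult_right[OF pure_tensor_bilinear]) (simp_all add: pure_tensor_closed)
  finally show ?case using Nil by simp
next
  case (Cons x xs)
  interpret T: module K T by (rule module_tensor)
  obtain m1 n1 where x: "x = (m1, n1)" "m1 \<in> carrier M" "n1 \<in> carrier N"
    using Cons.prems by (cases x) auto
  obtain w a where n: "n = w \<oplus>\<^bsub>N\<^esub> a \<odot>\<^bsub>N\<^esub> n1" "w \<in> lspan K N (map snd xs)" "a \<in> carrier K"
    using Cons.prems x by auto
  have w: "w \<in> carrier N"
  proof (rule submoduleD(1)[OF N.submodule_lspan n(2)])
    show "set (map snd xs) \<subseteq> carrier N" using Cons.prems(1) by auto
  qed
  obtain ys where ys: "length ys = length xs" "set ys \<subseteq> carrier M \<times> carrier N"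
    "pt m w \<oplus>\<^bsub>T\<^esub> tsum K M N xs = tsum K M N ys"
    using Cons.IH[OF _ _ n(2)] Cons.prems by auto
  note b = pure_tensor_bilinear
  have xs: "tsum K M N xs \<in> carrier T" using Cons.prems by (intro tsum_closed) simp
  have "pt m n = pt m w \<oplus>\<^bsub>T\<^esub> pt (a \<odot>\<^bsub>M\<^esub> m) n1"
    using n w x Cons.prems
    by (simp add: bilinear_add_right[OF b] bilinear_smult_right[OF b] bilinear_smult_left[OF b])
  then have "pt m n \<oplus>\<^bsub>T\<^esub> tsum K M N (x # xs)
      = (pt (a \<odot>\<^bsub>M\<^esub> m) n1 \<oplus>\<^bsub>T\<^esub> pt m1 n1) \<oplus>\<^bsub>T\<^esub> (pt m w \<oplus>\<^bsub>T\<^esub> tsum K M N xs)"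
    using n w x Cons.prems xs by (simp add: pure_tensor_closed T.M.a_ac)
  also have "\<dots> = tsum K M N ((a \<odot>\<^bsub>M\<^esub> m \<oplus>\<^bsub>M\<^esub> m1, n1) # ys)"
    using n x Cons.prems by (simp add: ys bilinear_add_left[OF b])
  finally show ?case
    using ys n x Cons.prems by (intro exI[of _ "(a \<odot>\<^bsub>M\<^esub> m \<oplus>\<^bsub>M\<^esub> m1, n1) # ys"]) auto
qed

text \<open>Injectivity of M \<otimes> N \<rightarrow> Hom(N*, M), by induction on the length of a
  representing list. If the first right factor depends on the others, its term is absorbed by them;
  otherwise a functional isolates that term and forces its left factor to be zero. Either way the
  list becomes shorter.\<close>

lemma contract_eq_zeroD:
  assumes "vectorspace K N" "t \<in> carrier T"
    and "\<And>f. f \<in> functionals K N \<Longrightarrow> contract K M N f t = \<zero>\<^bsub>M\<^esub>"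
  shows "t = \<zero>\<^bsub>T\<^esub>"
proof -
  interpret T: module K T by (rule module_tensor)
  interpret NV: vectorspace K N by fact
  obtain xs where xs: "set xs \<subseteq> carrier M \<times> carrier N" "t = tsum K M N xs"
    using tensor_repr[OF assms(2)] .
  then show ?thesis
    using assms(3)
  proof (induction "length xs" arbitrary: xs t)
    case (Suc k)
    then obtain x ys where x0: "xs = x # ys" by (cases xs) auto
    then obtain m n where x: "xs = (m, n) # ys" by (cases x) auto
    note prems = Suc.prems[unfolded x]
    have mn: "m \<in> carrier M" "n \<in> carrier N" and ys: "set ys \<subseteq> carrier M \<times> carrier N"
      using prems by auto
    have len: "k = length ys" using Suc x by simp
    have W: "submodule K (lspan K N (map snd ys)) N"
      using ys by (intro N.submodule_lspan) auto
    show ?case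
    proof (cases "n \<in> lspan K N (map snd ys)")
      case True
      obtain zs where "length zs = length ys" "set zs \<subseteq> carrier M \<times> carrier N"
        "pt m n \<oplus>\<^bsub>T\<^esub> tsum K M N ys = tsum K M N zs"
        using pure_add_tsum[OF ys mn(1) True] by blast
      then show ?thesis
        using Suc(1)[of zs t] len prems by simp
    next
      case False
      \<comment> \<open>This f is 1 on n and 0 on all remaining right factors, so contracting t with
        it leaves exactly m.\<close>
      obtain f where f: "f \<in> functionals K N" "f n = \<one>\<^bsub>K\<^esub>"
        "\<And>w. w \<in> lspan K N (map snd ys) \<Longrightarrow> f w = \<zero>\<^bsub>K\<^esub>"
        using NV.separating_functional[OF W mn(2) False] by blast
      have "lsum M (\<lambda>(m, n). f n \<odot>\<^bsub>M\<^esub> m) ys = lsum M (\<lambda>_. \<zero>\<^bsub>M\<^esub>) ys"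
      proof (rule lsum_cong)
        fix y assume y: "y \<in> set ys"
        then have "snd y \<in> lspan K N (map snd ys)" using ys by (intro N.in_lspan) auto
        then show "(case y of (m, n) \<Rightarrow> f n \<odot>\<^bsub>M\<^esub> m) = \<zero>\<^bsub>M\<^esub>"
          using f(3) y ys by (auto split: prod.splits)
      qed
      also have "\<dots> = \<zero>\<^bsub>M\<^esub>" by (induction ys) auto
      finally have "contract K M N f t = m"
        using f(2) mn unfolding prems(2) contract_tsum[OF f(1) prems(1)] by simp
      then have m: "m = \<zero>\<^bsub>M\<^esub>" using prems(3)[OF f(1)] by simp
      have "pt (\<zero>\<^bsub>K\<^esub> \<odot>\<^bsub>M\<^esub> m) n = \<zero>\<^bsub>T\<^esub>"
        using mn by (subst bilinear_smult_left[OF pure_tensor_bilinear]) (simp_all add: pure_tensor_closed)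
      then have "t = tsum K M N ys"
        using mn m prems(2) ys by (simp add: tsum_closed)
      then show ?thesis using Suc(1)[OF len ys] prems(3) by simp
    qed
  qed simp
qed

lemma contract_eqI:
  assumes "vectorspace K N" "s \<in> carrier T" "t \<in> carrier T"
    and "\<And>f. f \<in> functionals K N \<Longrightarrow> contract K M N f s = contract K M N f t"
  shows "s = t"
proof -
  interpret T: module K T by (rule module_tensor)
  have "s \<oplus>\<^bsub>T\<^esub> (\<ominus>\<^bsub>K\<^esub> \<one>\<^bsub>K\<^esub>) \<odot>\<^bsub>T\<^esub> t = \<zero>\<^bsub>T\<^esub>"
  proof (rule contract_eq_zeroD[OF assms(1)])
    fix f assume f: "f \<in> functionals K N"
    note h = contract_hom[OF f]
    show "contract K M N f (s \<oplus>\<^bsub>T\<^esub> (\<ominus>\<^bsub>K\<^esub> \<one>\<^bsub>K\<^esub>) \<odot>\<^bsub>T\<^esub> t) = \<zero>\<^bsub>M\<^esub>"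
      using assms f module_hom_in_carrier[OF h]
      by (simp add: module_hom_add[OF h] module_hom_smult[OF h] M.smult_l_minus M.M.r_neg)
  qed (use assms in auto)
  then have "s \<oplus>\<^bsub>T\<^esub> (\<ominus>\<^bsub>T\<^esub> t) = \<zero>\<^bsub>T\<^esub>" using assms by (simp add: T.smult_l_minus)
  then show ?thesis using T.M.minus_equality[of s "\<ominus>\<^bsub>T\<^esub> t"] assms by simp
qed

lemma tensor_subset_submodule:
  assumes "submodule K S T" "\<And>m n. \<lbrakk>m \<in> carrier M; n \<in> carrier N\<rbrakk> \<Longrightarrow> pt m n \<in> S"
    and t: "t \<in> carrier T"
  shows "t \<in> S"
proof -
  obtain xs where xs: "set xs \<subseteq> carrier M \<times> carrier N" "t = tsum K M N xs"
    using tensor_repr[OF t] .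
  have "tsum K M N xs \<in> S"
    using xs(1) by (induction xs) (auto simp: submoduleD[OF assms(1)] assms(2))
  then show ?thesis using xs by simp
qed

end

section \<open>Maps between tensor products\<close>

lemma
  assumes M: "module K M" and N: "module K N" and M': "module K M'" and N': "module K N'"
    and f: "f \<in> module_hom K M M'" and g: "g \<in> module_hom K N N'"
  shows tensor_map_hom: "tensor_map K M N M' N' f g \<in> module_hom K (tensor K M N) (tensor K M' N')"
    and tensor_map_pure: "\<lbrakk>m \<in> carrier M; n \<in> carrier N\<rbrakk> \<Longrightarrow>
      tensor_map K M N M' N' f g (pure_tensor K M N m n) = pure_tensor K M' N' (f m) (g n)"
proof -
  interpret A: two_modules K M N by (simp add: two_modules_def M N)
  interpret B: two_modules K M' N' by (simp add: two_modules_def M' N')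
  note b = B.pure_tensor_bilinear
  have *: "bilinear K M N (tensor K M' N') (\<lambda>m n. pure_tensor K M' N' (f m) (g n))"
    by (rule bilinearI)
      (simp_all add: module_hom_in_carrier[OF f] module_hom_in_carrier[OF g] B.pure_tensor_closed
        module_hom_add[OF f] module_hom_add[OF g] module_hom_smult[OF f] module_hom_smult[OF g]
        bilinear_add_left[OF b] bilinear_add_right[OF b]
        bilinear_smult_left[OF b] bilinear_smult_right[OF b])
  show "tensor_map K M N M' N' f g \<in> module_hom K (tensor K M N) (tensor K M' N')"
    unfolding tensor_map_def by (rule A.tensor_lift_hom[OF B.module_tensor *])
  show "tensor_map K M N M' N' f g (pure_tensor K M N m n) = pure_tensor K M' N' (f m) (g n)"
    if "m \<in> carrier M" "n \<in> carrier N"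
    unfolding tensor_map_def by (rule A.tensor_lift_pure[OF B.module_tensor * that])
qed

text \<open>\<open>tensor_assoc\<close> is a lift of lifts, so the inner lift must be shown to be
  bilinear as a function of the tensor t and the vector n before the outer one can be
  evaluated.\<close>

lemma
  assumes L: "module K L" and M: "module K M" and N: "module K N"
  shows tensor_assoc_hom: "tensor_assoc K L M N \<in>
      module_hom K (tensor K (tensor K L M) N) (tensor K L (tensor K M N))"
    and tensor_assoc_pure: "\<lbrakk>l \<in> carrier L; m \<in> carrier M; n \<in> carrier N\<rbrakk> \<Longrightarrow>
      tensor_assoc K L M N (pure_tensor K (tensor K L M) N (pure_tensor K L M l m) n) =
      pure_tensor K L (tensor K M N) l (pure_tensor K M N m n)"
proof -
  interpret LM: two_modules K L M by (simp add: two_modules_def L M)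
  interpret MN: two_modules K M N by (simp add: two_modules_def M N)
  interpret A: two_modules K "tensor K L M" N by (simp add: two_modules_def LM.module_tensor N)
  interpret B: two_modules K L "tensor K M N" by (simp add: two_modules_def MN.module_tensor L)
  let ?B = "tensor K L (tensor K M N)"
  let ?\<beta> = "\<lambda>n l m. pure_tensor K L (tensor K M N) l (pure_tensor K M N m n)"
  note b = MN.pure_tensor_bilinear B.pure_tensor_bilinear
  interpret BM: module K ?B by (rule B.module_tensor)
  have \<beta>: "bilinear K L M ?B (?\<beta> n)" if "n \<in> carrier N" for n
    using that
    by (intro bilinearI) (simp_all add: MN.pure_tensor_closed B.pure_tensor_closed
        b[THEN bilinear_add_left] b[THEN bilinear_add_right]
        b[THEN bilinear_smult_left] b[THEN bilinear_smult_right])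
  note lift = LM.tensor_lift_hom[OF B.module_tensor \<beta>]
  note lift_pure = LM.tensor_lift_pure[OF B.module_tensor \<beta>]
  note lift_in = module_hom_in_carrier[OF lift]
  \<comment> \<open>Linearity in t belongs to the inner lift. For linearity in n, both sides are
    linear in t, so they are compared on pure tensors only.\<close>
  have \<gamma>: "bilinear K (tensor K L M) N ?B (\<lambda>t n. tensor_lift K L M ?B (?\<beta> n) t)"
  proof (rule bilinearI)
    fix t n n' assume t: "t \<in> carrier (tensor K L M)" and n: "n \<in> carrier N" "n' \<in> carrier N"
    have nn': "n \<oplus>\<^bsub>N\<^esub> n' \<in> carrier N" using n by simp
    have "(\<lambda>t. tensor_lift K L M ?B (?\<beta> n) t \<oplus>\<^bsub>?B\<^esub> tensor_lift K L M ?B (?\<beta> n') t) \<in> module_hom K (tensor K L M) ?B"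
      by (rule module_homI)
        (simp_all add: n lift_in module_hom_add[OF lift] module_hom_smult[OF lift] BM.M.a_ac BM.smult_r_distr)
    then show "tensor_lift K L M ?B (?\<beta> (n \<oplus>\<^bsub>N\<^esub> n')) t =
        tensor_lift K L M ?B (?\<beta> n) t \<oplus>\<^bsub>?B\<^esub> tensor_lift K L M ?B (?\<beta> n') t"
      by (rule LM.tensor_hom_eqI[OF B.module_tensor lift[OF nn'] _ _ t])
        (simp add: n lift_pure nn' bilinear_add_right[OF b(1)] bilinear_add_right[OF b(2)] MN.pure_tensor_closed)
  next
    fix a t n assume t: "t \<in> carrier (tensor K L M)" and n: "a \<in> carrier K" "n \<in> carrier N"
    have nn': "a \<odot>\<^bsub>N\<^esub> n \<in> carrier N" using n by simp
    have "(\<lambda>t. a \<odot>\<^bsub>?B\<^esub> tensor_lift K L M ?B (?\<beta> n) t) \<in> module_hom K (tensor K L M) ?B"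
      by (rule module_homI)
        (simp_all add: n lift_in module_hom_add[OF lift] module_hom_smult[OF lift] BM.smult_r_distr
          BM.smult_assoc1[symmetric] LM.M.R.m_comm)
    then show "tensor_lift K L M ?B (?\<beta> (a \<odot>\<^bsub>N\<^esub> n)) t = a \<odot>\<^bsub>?B\<^esub> tensor_lift K L M ?B (?\<beta> n) t"
      by (rule LM.tensor_hom_eqI[OF B.module_tensor lift[OF nn'] _ _ t])
        (simp add: n lift_pure nn' bilinear_smult_right[OF b(1)] bilinear_smult_right[OF b(2)] MN.pure_tensor_closed)
  qed (simp_all add: lift_in module_hom_add[OF lift] module_hom_smult[OF lift])
  show "tensor_assoc K L M N \<in> module_hom K (tensor K (tensor K L M) N) ?B"
    unfolding tensor_assoc_def by (rule A.tensor_lift_hom[OF B.module_tensor \<gamma>])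
  show "tensor_assoc K L M N (pure_tensor K (tensor K L M) N (pure_tensor K L M l m) n) =
      pure_tensor K L (tensor K M N) l (pure_tensor K M N m n)"
    if "l \<in> carrier L" "m \<in> carrier M" "n \<in> carrier N"
    unfolding tensor_assoc_def
    by (simp only: A.tensor_lift_pure[OF B.module_tensor \<gamma>] LM.pure_tensor_closed that lift_pure)
qed

section \<open>Coassociativity in terms of contractions\<close>

text \<open>The image is a submodule that contains all l \<otimes> (m \<otimes> n), and these
  generate. Surjectivity is enough for what follows, so no inverse of the associator is
  constructed.\<close>

lemma tensor_assoc_surj:
  assumes L: "module K L" and M: "module K M" and N: "module K N"
    and z: "z \<in> carrier (tensor K L (tensor K M N))"
  shows "z \<in> tensor_assoc K L M N ` carrier (tensor K (tensor K L M) N)"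
proof -
  interpret LM: two_modules K L M by (simp add: two_modules_def L M)
  interpret MN: two_modules K M N by (simp add: two_modules_def M N)
  interpret A: two_modules K "tensor K L M" N by (simp add: two_modules_def LM.module_tensor N)
  interpret B: two_modules K L "tensor K M N" by (simp add: two_modules_def MN.module_tensor L)
  interpret BM: module K "tensor K L (tensor K M N)" by (rule B.module_tensor)
  interpret h: mod_hom K "tensor K (tensor K L M) N" "tensor K L (tensor K M N)" "tensor_assoc K L M N"
    by (simp add: mod_hom_def mod_hom_axioms_def A.module_tensor B.module_tensor tensor_assoc_hom L M N)
  note S = h.im_is_submodule[unfolded h.im_def] and b = B.pure_tensor_bilinear
  show ?thesis
  proof (rule B.tensor_subset_submodule[OF S _ z])
    fix l t assume l: "l \<in> carrier L" and t: "t \<in> carrier (tensor K M N)"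
    obtain xs where xs: "set xs \<subseteq> carrier M \<times> carrier N" "t = tsum K M N xs"
      using MN.tensor_repr[OF t] .
    have hom: "(\<lambda>t. pure_tensor K L (tensor K M N) l t)
        \<in> module_hom K (tensor K M N) (tensor K L (tensor K M N))"
      using b l by (simp add: bilinear_def)
    have pure: "pure_tensor K L (tensor K M N) l (pure_tensor K M N m n)
        \<in> tensor_assoc K L M N ` carrier (tensor K (tensor K L M) N)"
      if "m \<in> carrier M" "n \<in> carrier N" for m n
    proof -
      have "pure_tensor K (tensor K L M) N (pure_tensor K L M l m) n \<in> carrier (tensor K (tensor K L M) N)"
        using that l by (intro A.pure_tensor_closed LM.pure_tensor_closed)
      from imageI[OF this, of "tensor_assoc K L M N"] show ?thesis
        unfolding tensor_assoc_pure[OF L M N l that] .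
    qed
    have "lsum (tensor K L (tensor K M N))
          (\<lambda>(m, n). pure_tensor K L (tensor K M N) l (pure_tensor K M N m n)) xs
        \<in> tensor_assoc K L M N ` carrier (tensor K (tensor K L M) N)"
      using xs(1) by (induction xs) (auto simp: submoduleD(2,3)[OF S] pure)
    then show "pure_tensor K L (tensor K M N) l t
        \<in> tensor_assoc K L M N ` carrier (tensor K (tensor K L M) N)"
      unfolding xs(2) MN.hom_tsum[OF B.module_tensor hom xs(1)] .
  qed
qed

text \<open>The functional f \<otimes> g on C \<otimes> C. The convolution product of f and g is its
  composite with the comultiplication.\<close>

definition conv ::
  "('k, 'r) ring_scheme \<Rightarrow> ('k, 'c, 'x) module_scheme \<Rightarrow> ('c \<Rightarrow> 'k) \<Rightarrow> ('c \<Rightarrow> 'k)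
    \<Rightarrow> ('c \<times> 'c \<Rightarrow> 'k) set \<Rightarrow> 'k" where
  "conv K C f g = tensor_lift K C C (regular_module K) (\<lambda>a b. f a \<otimes>\<^bsub>K\<^esub> g b)"

context module
begin

lemma two_modules_self: "two_modules R M M"
  by (simp add: two_modules_def module_axioms)

lemma conv_bilinear:
  assumes f: "f \<in> functionals R M" and g: "g \<in> functionals R M"
  shows "bilinear R M M (regular_module R) (\<lambda>a b. f a \<otimes> g b)"
  using functionalD[OF f] functionalD[OF g]
  by (intro bilinearI) (simp_all add: l_distr r_distr m_assoc R.m_lcomm)

lemma
  assumes "f \<in> functionals R M" "g \<in> functionals R M"
  shows conv_hom: "conv R M f g \<in> functionals R (tensor R M M)"
    and conv_pure: "\<lbrakk>a \<in> carrier M; b \<in> carrier M\<rbrakk> \<Longrightarrow>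
      conv R M f g (pure_tensor R M M a b) = f a \<otimes> g b"
proof -
  note facts = module_regular_module[OF is_cring] conv_bilinear[OF assms]
  show "conv R M f g \<in> functionals R (tensor R M M)"
    "\<lbrakk>a \<in> carrier M; b \<in> carrier M\<rbrakk> \<Longrightarrow> conv R M f g (pure_tensor R M M a b) = f a \<otimes> g b"
    unfolding conv_def
    using two_modules.tensor_lift_hom[OF two_modules_self facts]
      two_modules.tensor_lift_pure[OF two_modules_self facts]
    by simp_all
qed

end

text \<open>Coassociativity says that (f * g) m = f (g m) for the induced action. Going back from
  this needs care: the hypothesis controls only the functionals f \<otimes> g, not all functionals
  on C \<otimes> C. So both sides are moved to (M \<otimes> C) \<otimes> C, where separate
  contractions with g and then f determine a tensor. As \<rho> and \<delta> are arbitrary linear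
  maps, the criterion covers coalgebras (M = C, \<rho> = \<delta>) as well as comodules.\<close>

lemma coassoc_iff_contract:
  assumes C: "vectorspace K C" and M: "module K M"
    and \<rho>: "\<rho> \<in> module_hom K M (tensor K M C)"
    and \<delta>: "\<delta> \<in> module_hom K C (tensor K C C)"
    and m: "m \<in> carrier M"
  shows "tensor_assoc K M C C (tensor_map K M C (tensor K M C) C \<rho> (\<lambda>x. x) (\<rho> m)) =
      tensor_map K M C M (tensor K C C) (\<lambda>x. x) \<delta> (\<rho> m) \<longleftrightarrow>
    (\<forall>f\<in>functionals K C. \<forall>g\<in>functionals K C.
      contract K M C f (\<rho> (contract K M C g (\<rho> m))) =
      contract K M C (\<lambda>c. conv K C f g (\<delta> c)) (\<rho> m))" (is "?l = ?r \<longleftrightarrow> ?P")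
proof -
  interpret C: vectorspace K C by fact
  have C': "module K C" ..
  interpret MC: two_modules K M C by (simp add: two_modules_def M C')
  interpret CC: two_modules K C C by (simp add: two_modules_def C')
  note CCm = CC.module_tensor
  interpret X: two_modules K "tensor K M C" C by (simp add: two_modules_def MC.module_tensor C')
  interpret Z: two_modules K M "tensor K C C" by (simp add: two_modules_def M CCm)
  have id: "(\<lambda>x. x) \<in> module_hom K C C" "(\<lambda>x. x) \<in> module_hom K M M"
    by (auto intro: module_homI)
  note map_\<rho> = tensor_map_hom[OF M C' MC.module_tensor C' \<rho> id(1)]
    and map_\<rho>_pure = tensor_map_pure[OF M C' MC.module_tensor C' \<rho> id(1)]
  note map_\<delta> = tensor_map_hom[OF M C' M CCm id(2) \<delta>]
    and map_\<delta>_pure = tensor_map_pure[OF M C' M CCm id(2) \<delta>]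
  note assoc = tensor_assoc_hom[OF M C' C'] and assoc_pure = tensor_assoc_pure[OF M C' C']
  have \<rho>m: "\<rho> m \<in> carrier (tensor K M C)" by (rule module_hom_in_carrier[OF \<rho> m])
  have conv_\<delta>: "(\<lambda>c. conv K C f g (\<delta> c)) \<in> functionals K C"
    if "f \<in> functionals K C" "g \<in> functionals K C" for f g
    by (rule module_hom_compose[OF \<delta> C.conv_hom[OF that]])
  have R: "contract K M (tensor K C C) (conv K C f g) ?r = contract K M C (\<lambda>c. conv K C f g (\<delta> c)) (\<rho> m)"
    if f: "f \<in> functionals K C" and g: "g \<in> functionals K C" for f g
    by (rule MC.tensor_hom_eqI[OF M module_hom_compose[OF map_\<delta> Z.contract_hom[OF C.conv_hom[OF f g]]]
          MC.contract_hom[OF conv_\<delta>[OF f g]] _ \<rho>m])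
      (simp add: map_\<delta>_pure Z.contract_pure C.conv_hom f g module_hom_in_carrier[OF \<delta>]
        MC.contract_pure conv_\<delta>)
  \<comment> \<open>Across the associator, contracting with f \<otimes> g becomes contracting with g
    and then with f. Both sides are linear, so this is checked first on pure outer tensors and then
    on pure inner ones.\<close>
  have A: "contract K M (tensor K C C) (conv K C f g) (tensor_assoc K M C C x) =
      contract K M C f (contract K (tensor K M C) C g x)"
    if f: "f \<in> functionals K C" and g: "g \<in> functionals K C"
      and x: "x \<in> carrier (tensor K (tensor K M C) C)" for f g x
  proof (rule X.tensor_hom_eqI[OF M module_hom_compose[OF assoc Z.contract_hom[OF C.conv_hom[OF f g]]]
          module_hom_compose[OF X.contract_hom[OF g] MC.contract_hom[OF f]] _ x])
    fix t c assume t: "t \<in> carrier (tensor K M C)" and c: "c \<in> carrier C"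
    have pure_hom: "(\<lambda>t. pure_tensor K (tensor K M C) C t c)
        \<in> module_hom K (tensor K M C) (tensor K (tensor K M C) C)"
      using X.pure_tensor_bilinear c by (simp add: bilinear_def)
    show "contract K M (tensor K C C) (conv K C f g)
          (tensor_assoc K M C C (pure_tensor K (tensor K M C) C t c)) =
        contract K M C f (contract K (tensor K M C) C g (pure_tensor K (tensor K M C) C t c))"
    proof (rule MC.tensor_hom_eqI[OF M module_hom_compose[OF module_hom_compose[OF pure_hom assoc]
              Z.contract_hom[OF C.conv_hom[OF f g]]]
          module_hom_compose[OF module_hom_compose[OF pure_hom X.contract_hom[OF g]] MC.contract_hom[OF f]] _ t])
      fix x d assume xd: "x \<in> carrier M" "d \<in> carrier C"
      show "contract K M (tensor K C C) (conv K C f g)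
          (tensor_assoc K M C C (pure_tensor K (tensor K M C) C (pure_tensor K M C x d) c)) =
        contract K M C f (contract K (tensor K M C) C g (pure_tensor K (tensor K M C) C (pure_tensor K M C x d) c))"
        using xd c functionalD(1)[OF f] functionalD(1)[OF g]
        by (simp add: assoc_pure Z.contract_pure C.conv_hom f g CC.pure_tensor_closed C.conv_pure
            X.contract_pure MC.pure_tensor_closed module_hom_smult[OF MC.contract_hom[OF f]]
            MC.contract_pure MC.M.smult_assoc1[symmetric] C.R.m_comm)
    qed
  qed
  \<comment> \<open>Linearity of \<rho> lets the contraction of the second factor pass through
    \<rho> \<otimes> id.\<close>
  have L: "contract K (tensor K M C) C g (tensor_map K M C (tensor K M C) C \<rho> (\<lambda>x. x) (\<rho> m)) =
      \<rho> (contract K M C g (\<rho> m))" if g: "g \<in> functionals K C" for g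
    by (rule MC.tensor_hom_eqI[OF MC.module_tensor module_hom_compose[OF map_\<rho> X.contract_hom[OF g]]
          module_hom_compose[OF MC.contract_hom[OF g] \<rho>] _ \<rho>m])
      (simp add: map_\<rho>_pure X.contract_pure g module_hom_in_carrier[OF \<rho>] MC.contract_pure
        module_hom_smult[OF \<rho>] functionalD(1)[OF g])
  have map_\<rho>m: "tensor_map K M C (tensor K M C) C \<rho> (\<lambda>x. x) (\<rho> m) \<in> carrier (tensor K (tensor K M C) C)"
    by (rule module_hom_in_carrier[OF map_\<rho> \<rho>m])
  show ?thesis
  proof
    assume "?l = ?r"
    then show ?P using R A[OF _ _ map_\<rho>m] L by simp
  next
    assume P: ?P
    have "?r \<in> carrier (tensor K M (tensor K C C))"
      by (rule module_hom_in_carrier[OF map_\<delta> \<rho>m])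
    \<comment> \<open>The right-hand side is pulled back through the associator, and its preimage y
      is identified with the tensor to which the associator is applied on the left.\<close>
    then obtain y where y: "y \<in> carrier (tensor K (tensor K M C) C)" "?r = tensor_assoc K M C C y"
      using tensor_assoc_surj[OF M C' C'] by blast
    have "tensor_map K M C (tensor K M C) C \<rho> (\<lambda>x. x) (\<rho> m) = y" (is "?x = y")
    proof (rule X.contract_eqI[OF C map_\<rho>m y(1)])
      fix g assume g: "g \<in> functionals K C"
      show "contract K (tensor K M C) C g ?x = contract K (tensor K M C) C g y"
      proof (rule MC.contract_eqI[OF C])
        show "contract K (tensor K M C) C g ?x \<in> carrier (tensor K M C)"
          "contract K (tensor K M C) C g y \<in> carrier (tensor K M C)"
          using module_hom_in_carrier[OF X.contract_hom[OF g]] map_\<rho>m y by blast+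
        fix f assume f: "f \<in> functionals K C"
        have "contract K M C f (contract K (tensor K M C) C g y) =
            contract K M C (\<lambda>c. conv K C f g (\<delta> c)) (\<rho> m)"
          using A[OF f g y(1)] R[OF f g] y(2) by simp
        then show "contract K M C f (contract K (tensor K M C) C g ?x) =
            contract K M C f (contract K (tensor K M C) C g y)"
          using P f g L[OF g] by simp
      qed
    qed
    then show "?l = ?r" using y(2) by simp
  qed
qed

section \<open>The dual algebra\<close>

lemma comodule_action_eq_contract: "comodule_action K C M \<rho> f m = contract K M C f (\<rho> m)"
  by (simp add: comodule_action_def contract_def)

lemma conv_cong:
  assumes "\<And>c. c \<in> carrier C \<Longrightarrow> f c = f' c" "\<And>c. c \<in> carrier C \<Longrightarrow> g c = g' c"
  shows "conv K C f g = conv K C f' g'"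
  unfolding conv_def by (rule tensor_lift_cong) (simp add: assms)

lemma functional_restrict:
  "module K C \<Longrightarrow> f \<in> functionals K C \<Longrightarrow> restrict f (carrier C) \<in> carrier (dual_algebra K C)"
  by (simp add: dual_algebra_def module_hom_restrict)

lemma dual_algebra_simps [simp]:
  "\<one>\<^bsub>dual_algebra K C\<^esub> = restrict (counit C) (carrier C)"
  "\<zero>\<^bsub>dual_algebra K C\<^esub> = (\<lambda>c\<in>carrier C. \<zero>\<^bsub>K\<^esub>)"
  "f \<oplus>\<^bsub>dual_algebra K C\<^esub> g = (\<lambda>c\<in>carrier C. f c \<oplus>\<^bsub>K\<^esub> g c)"
  "a \<odot>\<^bsub>dual_algebra K C\<^esub> f = (\<lambda>c\<in>carrier C. a \<otimes>\<^bsub>K\<^esub> f c)"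
  by (simp_all add: dual_algebra_def)

lemma dual_algebra_mult:
  "f \<otimes>\<^bsub>dual_algebra K C\<^esub> g = (\<lambda>c\<in>carrier C. conv K C f g (comult C c))"
  by (simp add: dual_algebra_def conv_def)

lemma dual_algebraD:
  assumes "f \<in> carrier (dual_algebra K C)"
  shows "f \<in> functionals K C" "f \<in> extensional (carrier C)" "restrict f (carrier C) = f"
  using assms by (simp_all add: dual_algebra_def extensional_restrict)

lemma dual_algebra_eqI:
  assumes "f \<in> carrier (dual_algebra K C)" "g \<in> carrier (dual_algebra K C)"
    and "\<And>c. c \<in> carrier C \<Longrightarrow> f c = g c"
  shows "f = g"
  using assms by (intro extensionalityI[of _ "carrier C"]) (simp_all add: dual_algebraD)

context coalgebra
begin

abbreviation (input) A where "A \<equiv> dual_algebra K C"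

lemma module_C: "module K C" ..

lemma vectorspace_C: "vectorspace K C" ..

lemma cring_K: "cring K" ..

lemma module_reg: "module K (regular_module K)"
  by (rule module_regular_module[OF cring_K])

lemmas CC = two_modules_self
lemmas module_CC = two_modules.module_tensor[OF two_modules_self]

lemma comult_closed: "c \<in> carrier C \<Longrightarrow> comult C c \<in> carrier (tensor K C C)"
  by (rule module_hom_in_carrier[OF comult_hom])

lemma conv_comult_functional:
  "\<lbrakk>f \<in> functionals K C; g \<in> functionals K C\<rbrakk> \<Longrightarrow> (\<lambda>c. conv K C f g (comult C c)) \<in> functionals K C"
  by (rule module_hom_compose[OF comult_hom conv_hom])

text \<open>C regarded as a right comodule over itself, with the comultiplication as
  coaction.\<close>

lemma contract_comult:
  "\<lbrakk>f \<in> functionals K C; g \<in> functionals K C; c \<in> carrier C\<rbrakk> \<Longrightarrow>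
    contract K C C f (comult C (contract K C C g (comult C c))) =
    contract K C C (\<lambda>c. conv K C f g (comult C c)) (comult C c)"
  using coassoc_iff_contract[OF vectorspace_C module_C comult_hom comult_hom] coassoc by blast

text \<open>The factorization f \<otimes> g = f \<circ> (id \<otimes> g) reduces statements about
  convolution to statements about contractions.\<close>

lemma conv_eq_contract:
  assumes f: "f \<in> functionals K C" and g: "g \<in> functionals K C" and t: "t \<in> carrier (tensor K C C)"
  shows "conv K C f g t = f (contract K C C g t)"
  by (rule two_modules.tensor_hom_eqI[OF CC module_reg conv_hom[OF f g] module_hom_compose[OF
        two_modules.contract_hom[OF CC g] f] _ t])
    (simp add: two_modules.contract_pure[OF CC] f g conv_pure functionalD[OF f] functionalD[OF g] R.m_comm)

lemma contract_closed:
  "\<lbrakk>f \<in> functionals K C; c \<in> carrier C\<rbrakk> \<Longrightarrow> contract K C C f (comult C c) \<in> carrier C"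
  by (rule module_hom_in_carrier[OF two_modules.contract_hom[OF CC] comult_closed])

text \<open>Both sides become f applied to an iterated contraction of \<open>comult C c\<close>, so
  this is \<open>contract_comult\<close> with f applied to it.\<close>

lemma conv_assoc:
  assumes f: "f \<in> functionals K C" and g: "g \<in> functionals K C" and h: "h \<in> functionals K C"
    and c: "c \<in> carrier C"
  shows "conv K C (\<lambda>c. conv K C f g (comult C c)) h (comult C c) =
    conv K C f (\<lambda>c. conv K C g h (comult C c)) (comult C c)"
proof -
  have "conv K C (\<lambda>c. conv K C f g (comult C c)) h (comult C c) =
      f (contract K C C g (comult C (contract K C C h (comult C c))))"
    using assms by (simp add: conv_eq_contract conv_comult_functional comult_closed contract_closed)
  also have "\<dots> = conv K C f (\<lambda>c. conv K C g h (comult C c)) (comult C c)"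
    using assms by (simp add: contract_comult conv_eq_contract[of f] conv_comult_functional comult_closed)
  finally show ?thesis .
qed

lemma conv_counit_right:
  assumes f: "f \<in> functionals K C" and c: "c \<in> carrier C"
  shows "conv K C f (counit C) (comult C c) = f c"
  using counit_right[OF c]
  by (simp add: conv_eq_contract f c counit_hom comult_closed contract_def)

text \<open>\<open>contract\<close> evaluates the right tensor factor only, so the left counit law
  needs its own comparison on pure tensors.\<close>

lemma conv_counit_left:
  assumes f: "f \<in> functionals K C" and c: "c \<in> carrier C"
  shows "conv K C (counit C) f (comult C c) = f c"
proof -
  note e = functionalD[OF counit_hom]
  have b: "bilinear K C C C (\<lambda>a b. counit C a \<odot>\<^bsub>C\<^esub> b)"
    by (rule bilinearI) (simp_all add: e smult_l_distr smult_r_distr smult_assoc1[symmetric] R.m_comm)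
  note lift = two_modules.tensor_lift_hom[OF CC module_C b]
    and lift_pure = two_modules.tensor_lift_pure[OF CC module_C b]
  have "conv K C (counit C) f (comult C c) =
      f (tensor_lift K C C C (\<lambda>a b. counit C a \<odot>\<^bsub>C\<^esub> b) (comult C c))"
    by (rule two_modules.tensor_hom_eqI[OF CC module_reg conv_hom[OF counit_hom f]
          module_hom_compose[OF lift f] _ comult_closed[OF c]])
      (simp add: lift_pure f counit_hom conv_pure functionalD[OF f] e)
  then show ?thesis by (simp add: counit_left[OF c])
qed

lemma functional_add:
  "\<lbrakk>f \<in> functionals K N; g \<in> functionals K N\<rbrakk> \<Longrightarrow> (\<lambda>c. f c \<oplus>\<^bsub>K\<^esub> g c) \<in> functionals K N"
  by (rule module_homI) (simp_all add: functionalD R.r_distr R.a_ac)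

lemma functional_smult:
  "\<lbrakk>a \<in> carrier K; f \<in> functionals K N\<rbrakk> \<Longrightarrow> (\<lambda>c. a \<otimes>\<^bsub>K\<^esub> f c) \<in> functionals K N"
  by (rule module_homI) (simp_all add: functionalD R.r_distr R.m_ac)

lemma functional_zero: "(\<lambda>c. \<zero>\<^bsub>K\<^esub>) \<in> functionals K N"
  by (rule module_homI) simp_all

lemma
  assumes f: "f \<in> functionals K C" and g: "g \<in> functionals K C" and h: "h \<in> functionals K C"
    and t: "t \<in> carrier (tensor K C C)"
  shows conv_add_left: "conv K C (\<lambda>c. f c \<oplus>\<^bsub>K\<^esub> g c) h t = conv K C f h t \<oplus>\<^bsub>K\<^esub> conv K C g h t"
    and conv_add_right: "conv K C h (\<lambda>c. f c \<oplus>\<^bsub>K\<^esub> g c) t = conv K C h f t \<oplus>\<^bsub>K\<^esub> conv K C h g t"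
proof -
  note c = functionalD[OF f] functionalD[OF g] functionalD[OF h]
  note fg = functional_add[OF f g]
  show "conv K C (\<lambda>c. f c \<oplus>\<^bsub>K\<^esub> g c) h t = conv K C f h t \<oplus>\<^bsub>K\<^esub> conv K C g h t"
    by (rule two_modules.tensor_hom_eqI[OF CC module_reg conv_hom[OF fg h]
          functional_add[OF conv_hom[OF f h] conv_hom[OF g h]] _ t])
      (simp add: conv_pure fg f g h c R.l_distr)
  show "conv K C h (\<lambda>c. f c \<oplus>\<^bsub>K\<^esub> g c) t = conv K C h f t \<oplus>\<^bsub>K\<^esub> conv K C h g t"
    by (rule two_modules.tensor_hom_eqI[OF CC module_reg conv_hom[OF h fg]
          functional_add[OF conv_hom[OF h f] conv_hom[OF h g]] _ t])
      (simp add: conv_pure fg f g h c R.r_distr)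
qed

lemma
  assumes f: "f \<in> functionals K C" and g: "g \<in> functionals K C" and a: "a \<in> carrier K"
    and t: "t \<in> carrier (tensor K C C)"
  shows conv_smult_left: "conv K C (\<lambda>c. a \<otimes>\<^bsub>K\<^esub> f c) g t = a \<otimes>\<^bsub>K\<^esub> conv K C f g t"
    and conv_smult_right: "conv K C f (\<lambda>c. a \<otimes>\<^bsub>K\<^esub> g c) t = a \<otimes>\<^bsub>K\<^esub> conv K C f g t"
proof -
  note c = functionalD[OF f] functionalD[OF g]
  note af = functional_smult[OF a f] and ag = functional_smult[OF a g]
  show "conv K C (\<lambda>c. a \<otimes>\<^bsub>K\<^esub> f c) g t = a \<otimes>\<^bsub>K\<^esub> conv K C f g t"
    by (rule two_modules.tensor_hom_eqI[OF CC module_reg conv_hom[OF af g]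
          functional_smult[OF a conv_hom[OF f g]] _ t])
      (simp add: conv_pure af f g c a R.m_assoc)
  show "conv K C f (\<lambda>c. a \<otimes>\<^bsub>K\<^esub> g c) t = a \<otimes>\<^bsub>K\<^esub> conv K C f g t"
    by (rule two_modules.tensor_hom_eqI[OF CC module_reg conv_hom[OF f ag]
          functional_smult[OF a conv_hom[OF f g]] _ t])
      (simp add: conv_pure ag f g c a R.m_lcomm)
qed

lemma dual_one_closed: "\<one>\<^bsub>A\<^esub> \<in> carrier A"
  by (simp add: functional_restrict[OF module_C counit_hom])

lemma dual_smult_closed: "\<lbrakk>a \<in> carrier K; f \<in> carrier A\<rbrakk> \<Longrightarrow> a \<odot>\<^bsub>A\<^esub> f \<in> carrier A"
  by (simp add: functional_restrict[OF module_C] functional_smult dual_algebraD)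

lemma dual_mult_closed: "\<lbrakk>f \<in> carrier A; g \<in> carrier A\<rbrakk> \<Longrightarrow> f \<otimes>\<^bsub>A\<^esub> g \<in> carrier A"
  by (simp add: dual_algebra_mult functional_restrict[OF module_C] conv_comult_functional dual_algebraD)

lemma conv_restrict:
  "conv K C (restrict f (carrier C)) g = conv K C f g"
  "conv K C f (restrict g (carrier C)) = conv K C f g"
  by (rule conv_cong; simp)+

lemma ring_dual_algebra: "ring A"
proof (rule ringI)
  show "abelian_group A"
  proof (rule abelian_groupI)
    fix f assume f: "f \<in> carrier A"
    then show "\<exists>g\<in>carrier A. g \<oplus>\<^bsub>A\<^esub> f = \<zero>\<^bsub>A\<^esub>"
      using functionalD(1)[OF dual_algebraD(1)[OF f]]
      \<comment> \<open>The additive inverse of f is supplied as the scalar multiple by -1.\<close>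
      by (intro bexI[OF _ dual_smult_closed[OF _ f, of "\<ominus>\<^bsub>K\<^esub> \<one>\<^bsub>K\<^esub>"]])
        (auto simp: R.l_minus R.l_neg intro!: restrict_ext)
  next
    fix f assume f: "f \<in> carrier A"
    show "\<zero>\<^bsub>A\<^esub> \<oplus>\<^bsub>A\<^esub> f = f"
      by (rule dual_algebra_eqI[OF _ f])
        (simp_all add: functionalD(1)[OF dual_algebraD(1)[OF f]] functional_restrict[OF module_C]
          functional_add functional_zero dual_algebraD[OF f] f cong: restrict_cong)
  qed (auto simp: functional_restrict[OF module_C] functional_add functional_zero dual_algebraD
      functionalD(1)[OF dual_algebraD(1)] R.a_ac intro!: restrict_ext)
  show "monoid A"
  proof (rule monoidI)
    fix f g h assume *: "f \<in> carrier A" "g \<in> carrier A" "h \<in> carrier A"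
    show "(f \<otimes>\<^bsub>A\<^esub> g) \<otimes>\<^bsub>A\<^esub> h = f \<otimes>\<^bsub>A\<^esub> (g \<otimes>\<^bsub>A\<^esub> h)"
      using * by (auto simp: dual_algebra_mult conv_restrict conv_assoc dual_algebraD intro!: restrict_ext)
  next
    fix f assume f: "f \<in> carrier A"
    show "\<one>\<^bsub>A\<^esub> \<otimes>\<^bsub>A\<^esub> f = f"
      by (rule dual_algebra_eqI[OF dual_mult_closed[OF dual_one_closed f] f])
        (simp add: dual_algebra_mult conv_restrict conv_counit_left dual_algebraD[OF f])
    show "f \<otimes>\<^bsub>A\<^esub> \<one>\<^bsub>A\<^esub> = f"
      by (rule dual_algebra_eqI[OF dual_mult_closed[OF f dual_one_closed] f])
        (simp add: dual_algebra_mult conv_restrict conv_counit_right dual_algebraD[OF f])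
  qed (simp_all add: dual_mult_closed dual_one_closed del: dual_algebra_simps)
  fix f g h assume *: "f \<in> carrier A" "g \<in> carrier A" "h \<in> carrier A"
  note d = *[THEN dual_algebraD(1)]
  show "(f \<oplus>\<^bsub>A\<^esub> g) \<otimes>\<^bsub>A\<^esub> h = f \<otimes>\<^bsub>A\<^esub> h \<oplus>\<^bsub>A\<^esub> g \<otimes>\<^bsub>A\<^esub> h"
    using d by (auto simp: dual_algebra_mult conv_restrict conv_add_left comult_closed intro!: restrict_ext)
  show "h \<otimes>\<^bsub>A\<^esub> (f \<oplus>\<^bsub>A\<^esub> g) = h \<otimes>\<^bsub>A\<^esub> f \<oplus>\<^bsub>A\<^esub> h \<otimes>\<^bsub>A\<^esub> g"
    using d by (auto simp: dual_algebra_mult conv_restrict conv_add_right comult_closed intro!: restrict_ext)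
qed

lemma smult_dual_one: "a \<odot>\<^bsub>A\<^esub> \<one>\<^bsub>A\<^esub> = restrict (\<lambda>c. a \<otimes>\<^bsub>K\<^esub> counit C c) (carrier C)"
  by (auto intro!: restrict_ext)

lemma scalar_mult_left:
  assumes a: "a \<in> carrier K" and f: "f \<in> carrier A"
  shows "(a \<odot>\<^bsub>A\<^esub> \<one>\<^bsub>A\<^esub>) \<otimes>\<^bsub>A\<^esub> f = a \<odot>\<^bsub>A\<^esub> f"
  using a dual_algebraD(1)[OF f] unfolding smult_dual_one dual_algebra_mult conv_restrict
  by (auto simp: conv_smult_left counit_hom comult_closed conv_counit_left intro!: restrict_ext)

text \<open>Together with \<open>scalar_mult_left\<close>, this makes the elements a \<epsilon>
  central in the dual algebra. Centrality is what makes a reconstructed coaction compatible with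
  scalars.\<close>

lemma scalar_mult_right:
  assumes a: "a \<in> carrier K" and f: "f \<in> carrier A"
  shows "f \<otimes>\<^bsub>A\<^esub> (a \<odot>\<^bsub>A\<^esub> \<one>\<^bsub>A\<^esub>) = a \<odot>\<^bsub>A\<^esub> f"
  using a dual_algebraD(1)[OF f] unfolding smult_dual_one dual_algebra_mult conv_restrict
  by (auto simp: conv_smult_right counit_hom comult_closed conv_counit_right intro!: restrict_ext)

end

section \<open>Rational modules\<close>

lemma base_space_simps [simp]:
  "carrier (base_space A M) = carrier M" "\<zero>\<^bsub>base_space A M\<^esub> = \<zero>\<^bsub>M\<^esub>"
  "x \<oplus>\<^bsub>base_space A M\<^esub> y = x \<oplus>\<^bsub>M\<^esub> y"
  "a \<odot>\<^bsub>base_space A M\<^esub> x = (a \<odot>\<^bsub>A\<^esub> \<one>\<^bsub>A\<^esub>) \<odot>\<^bsub>M\<^esub> x"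
  by (simp_all add: base_space_def)

lemma abelian_group_base_space:
  assumes "abelian_group M"
  shows "abelian_group (base_space A M)"
proof -
  interpret abelian_group M by fact
  show ?thesis
    by (rule abelian_groupI) (auto simp: a_ac intro: l_neg bexI[of _ "\<ominus>\<^bsub>M\<^esub> _"])
qed

lemma lsum_base_space: "lsum (base_space A M) = lsum M"
  by (simp add: lsum_def fun_eq_iff)

definition has_coefficients ::
  "('k, 'r) ring_scheme \<Rightarrow> ('k, 'c, 'x) coalgebra_scheme \<Rightarrow> ('c \<Rightarrow> 'k, 'm, 'y) module_scheme
    \<Rightarrow> 'm \<Rightarrow> ('m \<times> 'c) list \<Rightarrow> bool" where
  "has_coefficients K C M m xs \<longleftrightarrow> set xs \<subseteq> carrier M \<times> carrier C \<and>
    (\<forall>f\<in>carrier (dual_algebra K C).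
      f \<odot>\<^bsub>M\<^esub> m = lsum M (\<lambda>(x, c). f c \<odot>\<^bsub>base_space (dual_algebra K C) M\<^esub> x) xs)"

text \<open>Any list of pairs representing the tensor \<rho> m will do: the action of f is the
  contraction with f, which is computed termwise on the list.\<close>

lemma rational_module_has_coefficients:
  assumes "rational_module K C M" and m: "m \<in> carrier M"
  shows "\<exists>xs. has_coefficients K C M m xs"
proof -
  let ?B = "base_space (dual_algebra K C) M"
  obtain \<rho> where \<rho>: "right_comodule K C ?B \<rho>"
    and act: "\<And>f m. \<lbrakk>f \<in> carrier (dual_algebra K C); m \<in> carrier M\<rbrakk> \<Longrightarrow>
      f \<odot>\<^bsub>M\<^esub> m = comodule_action K C ?B \<rho> f m"
    using assms(1) by (auto simp: rational_module_def)
  interpret right_comodule K C ?B \<rho> by (rule \<rho>)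
  interpret BC: two_modules K ?B C
    using M.vectorspace_axioms by (simp add: two_modules_def C.module_C vectorspace_def)
  have "\<rho> m \<in> carrier (tensor K ?B C)"
    using module_hom_in_carrier[OF coaction_hom] m by simp
  then obtain xs where xs: "set xs \<subseteq> carrier ?B \<times> carrier C" "\<rho> m = tsum K ?B C xs"
    by (rule BC.tensor_repr)
  then have "has_coefficients K C M m xs"
    unfolding has_coefficients_def
    using act[OF _ m] BC.contract_tsum[OF dual_algebraD(1) xs(1)]
    by (auto simp: comodule_action_eq_contract lsum_base_space simp del: base_space_simps(4))
  then show ?thesis by blast
qed

text \<open>The axioms are inherited because a \<mapsto> a \<epsilon> respects sums, products and
  units from K to the dual algebra.\<close>

lemma (in coalgebra) vectorspace_base_space:
  assumes "left_module (dual_algebra K C) M"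
  shows "vectorspace K (base_space (dual_algebra K C) M)"
proof -
  interpret LM: left_module "dual_algebra K C" M by fact
  let ?A = "dual_algebra K C"
  have one: "a \<odot>\<^bsub>?A\<^esub> \<one>\<^bsub>?A\<^esub> \<in> carrier ?A" if "a \<in> carrier K" for a
    by (rule dual_smult_closed[OF that dual_one_closed])
  have "module K (base_space ?A M)"
  proof (rule moduleI)
    show "cring K" by (rule cring_K)
    show "abelian_group (base_space ?A M)"
      by (rule abelian_group_base_space) (rule LM.M.abelian_group_axioms)
  next
    fix a b x assume *: "a \<in> carrier K" "b \<in> carrier K" "x \<in> carrier (base_space ?A M)"
    have "(a \<oplus>\<^bsub>K\<^esub> b) \<odot>\<^bsub>?A\<^esub> \<one>\<^bsub>?A\<^esub> = (a \<odot>\<^bsub>?A\<^esub> \<one>\<^bsub>?A\<^esub>) \<oplus>\<^bsub>?A\<^esub> (b \<odot>\<^bsub>?A\<^esub> \<one>\<^bsub>?A\<^esub>)"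
      using * functionalD(1)[OF counit_hom] by (auto simp: R.l_distr intro!: restrict_ext)
    then show "(a \<oplus>\<^bsub>K\<^esub> b) \<odot>\<^bsub>base_space ?A M\<^esub> x =
        a \<odot>\<^bsub>base_space ?A M\<^esub> x \<oplus>\<^bsub>base_space ?A M\<^esub> b \<odot>\<^bsub>base_space ?A M\<^esub> x"
      using * one by (simp add: LM.smult_l_distr del: dual_algebra_simps)
    have "(a \<otimes>\<^bsub>K\<^esub> b) \<odot>\<^bsub>?A\<^esub> \<one>\<^bsub>?A\<^esub> = (a \<odot>\<^bsub>?A\<^esub> \<one>\<^bsub>?A\<^esub>) \<otimes>\<^bsub>?A\<^esub> (b \<odot>\<^bsub>?A\<^esub> \<one>\<^bsub>?A\<^esub>)"
      unfolding scalar_mult_left[OF *(1) one[OF *(2)]]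
      using * functionalD(1)[OF counit_hom] by (auto simp: R.m_assoc intro!: restrict_ext)
    then show "(a \<otimes>\<^bsub>K\<^esub> b) \<odot>\<^bsub>base_space ?A M\<^esub> x = a \<odot>\<^bsub>base_space ?A M\<^esub> (b \<odot>\<^bsub>base_space ?A M\<^esub> x)"
      using * one by (simp add: LM.smult_assoc del: dual_algebra_simps)
  next
    fix x assume x: "x \<in> carrier (base_space ?A M)"
    have "\<one>\<^bsub>K\<^esub> \<odot>\<^bsub>?A\<^esub> \<one>\<^bsub>?A\<^esub> = \<one>\<^bsub>?A\<^esub>"
      using functionalD(1)[OF counit_hom] by (auto intro!: restrict_ext)
    then show "\<one>\<^bsub>K\<^esub> \<odot>\<^bsub>base_space ?A M\<^esub> x = x"
      using x by (simp add: LM.smult_one del: dual_algebra_simps)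
  qed (simp_all add: one LM.smult_closed LM.smult_r_distr del: dual_algebra_simps)
  then show ?thesis
    by (simp add: vectorspace_def field_axioms)
qed

text \<open>The coefficient lists assemble to a coaction because \<open>M \<otimes> C\<close> embeds into the linear
  maps \<open>C\<^sup>* \<rightarrow> M\<close>; coassociativity is the associativity of the action seen through this embedding.\<close>

lemma (in coalgebra) rational_moduleI:
  assumes LM: "left_module (dual_algebra K C) M"
    and coeff: "\<And>m. m \<in> carrier M \<Longrightarrow> \<exists>xs. has_coefficients K C M m xs"
  shows "rational_module K C M"
proof -
  let ?A = "dual_algebra K C" and ?B = "base_space (dual_algebra K C) M"
  interpret LM: left_module ?A M by (rule LM)
  interpret B: vectorspace K ?B by (rule vectorspace_base_space[OF LM])
  interpret BC: two_modules K ?B C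
    by (simp add: two_modules_def module_C B.module_axioms)
  interpret T: module K "tensor K ?B C" by (rule BC.module_tensor)
  have "\<forall>m\<in>carrier M. \<exists>xs. has_coefficients K C M m xs"
    using coeff by blast
  then obtain xs where xs: "\<And>m. m \<in> carrier M \<Longrightarrow> has_coefficients K C M m (xs m)"
    by (auto simp: bchoice_iff)
  \<comment> \<open>The lists are chosen independently for each m, so linearity of \<rho> is not
    built in. It follows from \<open>act\<close>: contracting \<rho> m with f gives the action of f
    on m, which is linear in m, and these contractions determine \<rho> m.\<close>
  define \<rho> where "\<rho> m = tsum K ?B C (xs m)" for m
  have \<rho>_closed: "\<rho> m \<in> carrier (tensor K ?B C)" if "m \<in> carrier M" for m
    unfolding \<rho>_def using xs[OF that] by (intro BC.tsum_closed) (auto simp: has_coefficients_def)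
  have res: "restrict f (carrier C) \<in> carrier ?A" if "f \<in> functionals K C" for f
    by (rule functional_restrict[OF module_C that])
  have act: "contract K ?B C f (\<rho> m) = restrict f (carrier C) \<odot>\<^bsub>M\<^esub> m"
    if f: "f \<in> functionals K C" and m: "m \<in> carrier M" for f m
  proof -
    have "contract K ?B C f (\<rho> m) = lsum M (\<lambda>(x, c). f c \<odot>\<^bsub>?B\<^esub> x) (xs m)"
      unfolding \<rho>_def using xs[OF m]
      by (subst BC.contract_tsum[OF f]) (auto simp: has_coefficients_def lsum_base_space)
    also have "\<dots> = lsum M (\<lambda>(x, c). restrict f (carrier C) c \<odot>\<^bsub>?B\<^esub> x) (xs m)"
      using xs[OF m] by (intro lsum_cong) (auto simp: has_coefficients_def simp del: base_space_simps(4))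
    also have "\<dots> = restrict f (carrier C) \<odot>\<^bsub>M\<^esub> m"
      using xs[OF m] res[OF f] by (simp add: has_coefficients_def del: base_space_simps(4))
    finally show ?thesis .
  qed
  have \<rho>_hom: "\<rho> \<in> module_hom K ?B (tensor K ?B C)"
  proof (rule module_homI)
    fix m n assume mn: "m \<in> carrier ?B" "n \<in> carrier ?B"
    show "\<rho> (m \<oplus>\<^bsub>?B\<^esub> n) = \<rho> m \<oplus>\<^bsub>tensor K ?B C\<^esub> \<rho> n"
    proof (rule BC.contract_eqI[OF vectorspace_C])
      fix f assume f: "f \<in> functionals K C"
      show "contract K ?B C f (\<rho> (m \<oplus>\<^bsub>?B\<^esub> n)) = contract K ?B C f (\<rho> m \<oplus>\<^bsub>tensor K ?B C\<^esub> \<rho> n)"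
        using mn by (simp add: module_hom_add[OF BC.contract_hom[OF f]] \<rho>_closed act f
            LM.smult_r_distr res)
    qed (use mn in \<open>simp_all add: \<rho>_closed\<close>)
  next
    fix a m assume a: "a \<in> carrier K" and m: "m \<in> carrier ?B"
    have am: "a \<odot>\<^bsub>?B\<^esub> m \<in> carrier M" using B.smult_closed[OF a m] by simp
    show "\<rho> (a \<odot>\<^bsub>?B\<^esub> m) = a \<odot>\<^bsub>tensor K ?B C\<^esub> \<rho> m"
    proof (rule BC.contract_eqI[OF vectorspace_C])
      fix f assume f: "f \<in> functionals K C"
      have one: "a \<odot>\<^bsub>?A\<^esub> \<one>\<^bsub>?A\<^esub> \<in> carrier ?A"
        by (rule dual_smult_closed[OF a dual_one_closed])
      \<comment> \<open>Here a acts before f, whereas on the other side it acts after f; centrality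
        of a \<epsilon> exchanges the two.\<close>
      have "contract K ?B C f (\<rho> (a \<odot>\<^bsub>?B\<^esub> m))
          = (restrict f (carrier C) \<otimes>\<^bsub>?A\<^esub> (a \<odot>\<^bsub>?A\<^esub> \<one>\<^bsub>?A\<^esub>)) \<odot>\<^bsub>M\<^esub> m"
        using m res[OF f] one unfolding act[OF f am] by (simp add: LM.smult_assoc del: dual_algebra_simps)
      also have "\<dots> = ((a \<odot>\<^bsub>?A\<^esub> \<one>\<^bsub>?A\<^esub>) \<otimes>\<^bsub>?A\<^esub> restrict f (carrier C)) \<odot>\<^bsub>M\<^esub> m"
        unfolding scalar_mult_left[OF a res[OF f]] scalar_mult_right[OF a res[OF f]] ..
      also have "\<dots> = contract K ?B C f (a \<odot>\<^bsub>tensor K ?B C\<^esub> \<rho> m)"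
        using m a res[OF f] one
        by (simp add: LM.smult_assoc module_hom_smult[OF BC.contract_hom[OF f]] \<rho>_closed act f
            del: dual_algebra_simps)
      finally show "contract K ?B C f (\<rho> (a \<odot>\<^bsub>?B\<^esub> m)) = contract K ?B C f (a \<odot>\<^bsub>tensor K ?B C\<^esub> \<rho> m)" .
    qed (use m a am in \<open>simp_all add: \<rho>_closed del: base_space_simps(4)\<close>)
  qed (simp add: \<rho>_closed)
  have "right_comodule K C ?B \<rho>"
  proof (intro right_comodule.intro right_comodule_axioms.intro)
    show "coalgebra K C" ..
    show "vectorspace K ?B" ..
    show "\<rho> \<in> module_hom K ?B (tensor K ?B C)" by (rule \<rho>_hom)
  next
    fix m assume m: "m \<in> carrier ?B"
    have "contract K ?B C f (\<rho> (contract K ?B C g (\<rho> m))) =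
        contract K ?B C (\<lambda>c. conv K C f g (comult C c)) (\<rho> m)"
      if f: "f \<in> functionals K C" and g: "g \<in> functionals K C" for f g
    proof -
      have "restrict f (carrier C) \<otimes>\<^bsub>?A\<^esub> restrict g (carrier C) =
          restrict (\<lambda>c. conv K C f g (comult C c)) (carrier C)"
        by (simp add: dual_algebra_mult conv_restrict)
      then show ?thesis
        using m LM.smult_assoc[OF res[OF f] res[OF g], of m]
        by (simp add: act f g conv_comult_functional LM.smult_closed res)
    qed
    then show "tensor_assoc K ?B C C (tensor_map K ?B C (tensor K ?B C) C \<rho> (\<lambda>x. x) (\<rho> m)) =
        tensor_map K ?B C ?B (tensor K C C) (\<lambda>x. x) (comult C) (\<rho> m)"
      using coassoc_iff_contract[OF vectorspace_C B.module_axioms \<rho>_hom comult_hom m] by blast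
    show "tensor_lift K ?B C ?B (\<lambda>x c. counit C c \<odot>\<^bsub>?B\<^esub> x) (\<rho> m) = m"
      \<comment> \<open>The counit is the unit of the dual algebra and therefore acts as the
        identity.\<close>
      using act[OF counit_hom, of m] LM.smult_one[of m] m by (simp add: contract_def)
  qed
  moreover have "f \<odot>\<^bsub>M\<^esub> m = comodule_action K C ?B \<rho> f m"
    if "f \<in> carrier ?A" "m \<in> carrier M" for f m
    using act[OF dual_algebraD(1) \<open>m \<in> carrier M\<close>, of f] that
    by (simp add: comodule_action_eq_contract dual_algebraD(3))
  ultimately show ?thesis using LM by (auto simp: rational_module_def)
qed

section \<open>Subcoalgebras\<close>

locale coalgebra_with_sub = coalgebra K C
  for K :: "('k, 'r) ring_scheme" and C :: "('k, 'c, 'x) coalgebra_scheme" +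
  fixes D :: "'c set"
  assumes sub: "subcoalgebra K D C"
begin

abbreviation (input) E where "E \<equiv> subcoalgebra_struct K C D"
abbreviation (input) incl where "incl \<equiv> tensor_square_incl K C D"

lemma submodule_D: "submodule K D C"
  using sub by (simp add: subcoalgebra_def subspace_def)

lemmas D_simps = submoduleD[OF submodule_D]

lemma E_simps [simp]:
  "carrier E = D" "\<zero>\<^bsub>E\<^esub> = \<zero>\<^bsub>C\<^esub>" "x \<oplus>\<^bsub>E\<^esub> y = x \<oplus>\<^bsub>C\<^esub> y" "a \<odot>\<^bsub>E\<^esub> x = a \<odot>\<^bsub>C\<^esub> x" "counit E = counit C"
  by (simp_all add: subcoalgebra_struct_def)

lemma module_E: "module K E"
proof (rule moduleI)
  show "abelian_group E"
  proof (rule abelian_groupI)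
    fix x assume x: "x \<in> carrier E"
    then have "\<zero>\<^bsub>C\<^esub> \<ominus>\<^bsub>C\<^esub> x \<in> D" by (intro submodule_minus[OF submodule_D]) (simp_all add: D_simps)
    then show "\<exists>y\<in>carrier E. y \<oplus>\<^bsub>E\<^esub> x = \<zero>\<^bsub>E\<^esub>"
      using x by (intro bexI[of _ "\<zero>\<^bsub>C\<^esub> \<ominus>\<^bsub>C\<^esub> x"]) (simp_all add: D_simps M.minus_eq M.l_neg)
  qed (simp_all add: D_simps M.a_ac)
qed (simp_all add: cring_K D_simps smult_l_distr smult_r_distr smult_assoc1)

lemma vectorspace_E: "vectorspace K E"
  by (simp add: vectorspace_def module_E field_axioms)

lemma EE: "two_modules K E E"
  by (simp add: two_modules_def module_E)

lemma lsum_E: "lsum E = lsum C"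
  by (simp add: lsum_def fun_eq_iff)

text \<open>The definitions speak of C with its carrier replaced, whereas E also has a new
  comultiplication. Tensor products ignore that field, so everything can be phrased with E.\<close>

lemma tensor_E: "tensor K (C\<lparr>carrier := D\<rparr>) (C\<lparr>carrier := D\<rparr>) = tensor K E E"
  and incl_eq: "incl = tensor_map K E E C C (\<lambda>x. x) (\<lambda>x. x)"
  by (simp_all add: tensor_square_incl_def tensor_map_def tensor_lift_def tensor_def
      pure_tensor_def tensor_kernel_def tensor_relations_def)

lemma inclusion_hom: "(\<lambda>x. x) \<in> module_hom K E C"
  by (rule module_homI) (simp_all add: D_simps)

lemma functional_E: "f \<in> functionals K C \<Longrightarrow> f \<in> functionals K E"
  using module_hom_compose[OF inclusion_hom] .

lemma incl_hom: "incl \<in> module_hom K (tensor K E E) (tensor K C C)"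
  unfolding incl_eq by (rule tensor_map_hom[OF module_E module_E module_C module_C inclusion_hom inclusion_hom])

lemma incl_pure: "\<lbrakk>x \<in> D; y \<in> D\<rbrakk> \<Longrightarrow> incl (pure_tensor K E E x y) = pure_tensor K C C x y"
  unfolding incl_eq
  by (rule tensor_map_pure[OF module_E module_E module_C module_C inclusion_hom inclusion_hom]) simp_all

lemma incl_tsum:
  assumes "set xs \<subseteq> D \<times> D"
  shows "incl (tsum K E E xs) = tsum K C C xs"
proof -
  have "incl (tsum K E E xs) = lsum (tensor K C C) (\<lambda>(m, n). incl (pure_tensor K E E m n)) xs"
    using assms by (intro two_modules.hom_tsum[OF EE module_CC incl_hom]) simp
  also have "\<dots> = tsum K C C xs"
    unfolding tsum_def using assms by (intro lsum_cong) (auto simp: incl_pure)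
  finally show ?thesis .
qed

text \<open>A list of pairs from D represents a tensor over E and also its image over C, so both
  lifts evaluate to the same list sum. P and Q are separate because the target may be C on one side
  and E on the other; the hypothesis on \<open>lsum\<close> says that their sums agree.\<close>

lemma tensor_lift_incl:
  assumes "module K P" "bilinear K C C P \<beta>" "module K Q" "bilinear K E E Q \<beta>"
    and "\<And>xs. lsum P (\<lambda>(x, y). \<beta> x y) xs = lsum Q (\<lambda>(x, y). \<beta> x y) xs"
    and t: "t \<in> carrier (tensor K E E)"
  shows "tensor_lift K C C P \<beta> (incl t) = tensor_lift K E E Q \<beta> t"
proof -
  obtain xs where xs: "set xs \<subseteq> carrier E \<times> carrier E" "t = tsum K E E xs"
    using two_modules.tensor_repr[OF EE t] .
  then have "set xs \<subseteq> carrier C \<times> carrier C" using D_simps(1) by auto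
  with xs show ?thesis
    using assms(1-5)
    by (simp add: incl_tsum two_modules.tensor_lift_tsum[OF CC] two_modules.tensor_lift_tsum[OF EE])
qed

lemma contract_incl:
  assumes f: "f \<in> functionals K C" and t: "t \<in> carrier (tensor K E E)"
  shows "contract K C C f (incl t) = contract K E E f t"
proof -
  have "bilinear K E E E (\<lambda>m n. f n \<odot>\<^bsub>C\<^esub> m)"
    using two_modules.contract_bilinear[OF EE functional_E[OF f]] by simp
  from tensor_lift_incl[OF module_C two_modules.contract_bilinear[OF CC f] module_E this _ t]
  show ?thesis by (simp add: contract_def lsum_E)
qed

lemma conv_incl:
  "\<lbrakk>f \<in> functionals K C; g \<in> functionals K C; t \<in> carrier (tensor K E E)\<rbrakk> \<Longrightarrow>
    conv K C f g (incl t) = conv K E f g t"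
proof -
  interpret E: module K E by (rule module_E)
  show ?thesis if "f \<in> functionals K C" "g \<in> functionals K C" "t \<in> carrier (tensor K E E)"
    unfolding conv_def using that
    by (intro tensor_lift_incl[OF module_reg conv_bilinear module_reg E.conv_bilinear]) (simp_all add: functional_E)
qed

text \<open>An arbitrary linear retraction onto D; no compatibility with the comultiplication is
  asked of it.\<close>

definition proj :: "'c \<Rightarrow> 'c" where
  "proj = (SOME p. p \<in> module_hom K C (C\<lparr>carrier := D\<rparr>) \<and> (\<forall>d\<in>D. p d = d))"

lemma proj_hom: "proj \<in> module_hom K C E"
  and proj_id: "d \<in> D \<Longrightarrow> proj d = d"
proof -
  obtain p where "p \<in> module_hom K C (C\<lparr>carrier := D\<rparr>)" "\<And>d. d \<in> D \<Longrightarrow> p d = d"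
    using projection_exists[OF zero_submodule submodule_D] D_simps(3) by auto
  then have "\<exists>p. p \<in> module_hom K C (C\<lparr>carrier := D\<rparr>) \<and> (\<forall>d\<in>D. p d = d)" by blast
  from someI_ex[OF this] have *: "proj \<in> module_hom K C (C\<lparr>carrier := D\<rparr>)" "\<forall>d\<in>D. proj d = d"
    unfolding proj_def by blast+
  show "proj \<in> module_hom K C E" using *(1) by (simp add: module_hom_def)
  show "d \<in> D \<Longrightarrow> proj d = d" using *(2) by blast
qed

lemma proj_in: "c \<in> carrier C \<Longrightarrow> proj c \<in> D"
  using module_hom_in_carrier[OF proj_hom] by simp

lemma functional_proj: "f \<in> functionals K E \<Longrightarrow> (\<lambda>c. f (proj c)) \<in> functionals K C"
  by (rule module_hom_compose[OF proj_hom])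

text \<open>Since f \<circ> \<open>proj\<close> extends f to C, contractions over E can be computed
  over C, where the coalgebra laws are available.\<close>

lemma contract_incl_proj:
  assumes "f \<in> functionals K E" "t \<in> carrier (tensor K E E)"
  shows "contract K E E f t = contract K C C (\<lambda>c. f (proj c)) (incl t)"
  unfolding contract_incl[OF functional_proj[OF assms(1)] assms(2)]
  by (rule fun_cong[OF contract_cong]) (simp add: proj_id)

lemma conv_incl_proj:
  assumes "f \<in> functionals K E" "g \<in> functionals K E" "t \<in> carrier (tensor K E E)"
  shows "conv K E f g t = conv K C (\<lambda>c. f (proj c)) (\<lambda>c. g (proj c)) (incl t)"
  unfolding conv_incl[OF functional_proj[OF assms(1)] functional_proj[OF assms(2)] assms(3)]
  by (rule fun_cong[OF conv_cong]) (simp_all add: proj_id)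

text \<open>Every contraction over E factors through \<open>incl\<close> by extending the
  functional, and contractions separate tensors.\<close>

lemma incl_inj:
  assumes "s \<in> carrier (tensor K E E)" "t \<in> carrier (tensor K E E)" "incl s = incl t"
  shows "s = t"
  by (rule two_modules.contract_eqI[OF EE vectorspace_E assms(1,2)])
    (simp add: contract_incl_proj assms)

text \<open>Justifies the definite description in \<open>subcoalgebra_struct\<close>: a preimage
  exists because D is a subcoalgebra and is unique by \<open>incl_inj\<close>.\<close>

lemma comult_E:
  assumes "d \<in> D"
  shows "comult E d \<in> carrier (tensor K E E)" "incl (comult E d) = comult C d"
proof -
  have "comult C d \<in> incl ` carrier (tensor K E E)"
    using sub assms unfolding subcoalgebra_def tensor_E by blast
  then obtain t where "t \<in> carrier (tensor K E E)" "incl t = comult C d" by force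
  then have "\<exists>!t. t \<in> carrier (tensor K E E) \<and> incl t = comult C d"
    by (metis incl_inj)
  moreover have "comult E d = (THE t. t \<in> carrier (tensor K E E) \<and> incl t = comult C d)"
    unfolding tensor_E[symmetric] by (simp add: subcoalgebra_struct_def)
  ultimately show "comult E d \<in> carrier (tensor K E E)" "incl (comult E d) = comult C d"
    by (metis (mono_tags, lifting) theI')+
qed

lemma comult_E_hom: "comult E \<in> module_hom K E (tensor K E E)"
proof (rule module_homI)
  interpret T: module K "tensor K E E" by (rule two_modules.module_tensor[OF EE])
  fix d assume "d \<in> carrier E"
  then have d: "d \<in> D" "d \<in> carrier C" by (simp_all add: D_simps)
  show "comult E d \<in> carrier (tensor K E E)" using comult_E(1) d by simp
  { fix e assume "e \<in> carrier E"
    then have e: "e \<in> D" "e \<in> carrier C" by (simp_all add: D_simps)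
    show "comult E (d \<oplus>\<^bsub>E\<^esub> e) = comult E d \<oplus>\<^bsub>tensor K E E\<^esub> comult E e"
      by (rule incl_inj) (use d e in \<open>simp_all add: comult_E D_simps
        module_hom_add[OF incl_hom] module_hom_add[OF comult_hom]\<close>) }
  { fix a assume a: "a \<in> carrier K"
    show "comult E (a \<odot>\<^bsub>E\<^esub> d) = a \<odot>\<^bsub>tensor K E E\<^esub> comult E d"
      by (rule incl_inj) (use d a in \<open>simp_all add: comult_E D_simps
        module_hom_smult[OF incl_hom] module_hom_smult[OF comult_hom]\<close>) }
qed

lemma conv_comult_E:
  assumes "f \<in> functionals K C" "g \<in> functionals K C" "d \<in> D"
  shows "conv K E f g (comult E d) = conv K C f g (comult C d)"
  using conv_incl[OF assms(1,2) comult_E(1)[OF assms(3)]] comult_E(2)[OF assms(3)] by simp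

text \<open>Coassociativity is transferred in its contracted form, with functionals on D extended to
  C, so no naturality of the associator is needed. The right counit law is a contraction too; the
  left one is not and goes through \<open>tensor_lift_incl\<close>.\<close>

lemma coalgebra_E: "coalgebra K E"
proof (intro coalgebra.intro coalgebra_axioms.intro)
  show "vectorspace K E" by (rule vectorspace_E)
  show "comult E \<in> module_hom K E (tensor K E E)" by (rule comult_E_hom)
  show "counit E \<in> module_hom K E (regular_module K)"
    using functional_E[OF counit_hom] by simp
  fix d assume dE: "d \<in> carrier E"
  then have d: "d \<in> D" "d \<in> carrier C" by (simp_all add: D_simps)
  have "contract K E E f (comult E (contract K E E g (comult E d))) =
      contract K E E (\<lambda>c. conv K E f g (comult E c)) (comult E d)"
    if f: "f \<in> functionals K E" and g: "g \<in> functionals K E" for f g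
  proof -
    let ?f = "\<lambda>c. f (proj c)" and ?g = "\<lambda>c. g (proj c)"
    note fg = functional_proj[OF f] functional_proj[OF g]
    have "contract K E E g (comult E d) \<in> D"
      using module_hom_in_carrier[OF two_modules.contract_hom[OF EE g] comult_E(1)[OF d(1)]] by simp
    then have "contract K E E f (comult E (contract K E E g (comult E d))) =
        contract K C C ?f (comult C (contract K C C ?g (comult C d)))"
      using f g d by (simp add: contract_incl_proj comult_E)
    also have "\<dots> = contract K C C (\<lambda>c. conv K C ?f ?g (comult C c)) (comult C d)"
      by (rule contract_comult[OF fg d(2)])
    \<comment> \<open>Returning to E requires a functional defined on all of C; the convolution of
      the two extended functionals is one.\<close>
    also have "\<dots> = contract K E E (\<lambda>c. conv K C ?f ?g (comult C c)) (comult E d)"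
      using contract_incl[OF conv_comult_functional[OF fg] comult_E(1)[OF d(1)]]
      by (simp add: comult_E(2)[OF d(1)])
    also have "\<dots> = contract K E E (\<lambda>c. conv K E f g (comult E c)) (comult E d)"
      by (rule fun_cong[OF contract_cong]) (simp add: conv_incl_proj f g comult_E)
    finally show ?thesis .
  qed
  then show "tensor_assoc K E E E (tensor_map K E E (tensor K E E) E (comult E) (\<lambda>x. x) (comult E d)) =
      tensor_map K E E E (tensor K E E) (\<lambda>x. x) (comult E) (comult E d)"
    using coassoc_iff_contract[OF vectorspace_E module_E comult_E_hom comult_E_hom dE] by blast
  show "tensor_lift K E E E (\<lambda>a b. counit E b \<odot>\<^bsub>E\<^esub> a) (comult E d) = d"
    using contract_incl[OF counit_hom comult_E(1)[OF d(1)]] counit_right[OF d(2)]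
    by (simp add: comult_E(2)[OF d(1)] contract_def)
  \<comment> \<open>Stated for a variable N because the transfer needs it both for C and for
    E.\<close>
  have b: "bilinear K N N N (\<lambda>a b. counit C a \<odot>\<^bsub>N\<^esub> b)"
    if "module K N" "counit C \<in> functionals K N" for N :: "('k, 'c, 'x) coalgebra_scheme"
  proof -
    interpret N: module K N by (rule that(1))
    show ?thesis
      using functionalD[OF that(2)]
      by (intro bilinearI) (simp_all add: N.smult_l_distr N.smult_r_distr N.smult_assoc1[symmetric] R.m_comm)
  qed
  have "tensor_lift K C C C (\<lambda>a b. counit C a \<odot>\<^bsub>C\<^esub> b) (incl (comult E d)) =
      tensor_lift K E E E (\<lambda>a b. counit C a \<odot>\<^bsub>C\<^esub> b) (comult E d)"
    using b[OF module_E functional_E[OF counit_hom]]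
    by (intro tensor_lift_incl[OF module_C b[OF module_C counit_hom] module_E _ _ comult_E(1)[OF d(1)]])
      (simp_all add: lsum_E)
  then show "tensor_lift K E E E (\<lambda>a b. counit E a \<odot>\<^bsub>E\<^esub> b) (comult E d) = d"
    using counit_left[OF d(2)] by (simp add: comult_E(2)[OF d(1)])
qed

end

section \<open>Inflation along the restriction of functionals\<close>

text \<open>Only \<open>smult\<close> changes, so carriers, sums and the maps of an extension are
  kept as they are. Using \<open>restrict\<close> also makes the functional undefined off D, as
  elements of the dual algebra of D must be.\<close>

definition inflate :: "'c set \<Rightarrow> ('c \<Rightarrow> 'k, 'm, 'y) module_scheme \<Rightarrow> ('c \<Rightarrow> 'k, 'm, 'y) module_scheme" where
  "inflate D M = M\<lparr>smult := \<lambda>f x. restrict f D \<odot>\<^bsub>M\<^esub> x\<rparr>"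

lemma inflate_simps [simp]:
  "carrier (inflate D M) = carrier M" "\<zero>\<^bsub>inflate D M\<^esub> = \<zero>\<^bsub>M\<^esub>"
  "x \<oplus>\<^bsub>inflate D M\<^esub> y = x \<oplus>\<^bsub>M\<^esub> y" "f \<odot>\<^bsub>inflate D M\<^esub> x = restrict f D \<odot>\<^bsub>M\<^esub> x"
  by (simp_all add: inflate_def)

lemma abelian_group_inflate:
  assumes "abelian_group M"
  shows "abelian_group (inflate D M)"
proof -
  interpret abelian_group M by fact
  show ?thesis
    by (rule abelian_groupI) (auto simp: a_ac intro: l_neg bexI[of _ "\<ominus>\<^bsub>M\<^esub> _"])
qed

context coalgebra_with_sub
begin

lemma carrier_Int_D [simp]: "carrier C \<inter> D = D"
  using D_simps(1) by blast

lemma dual_restrict: "f \<in> carrier (dual_algebra K C) \<Longrightarrow> restrict f D \<in> carrier (dual_algebra K E)"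
  using functional_restrict[OF module_E functional_E[OF dual_algebraD(1)]] by simp

text \<open>The restriction from the dual of C to the dual of D is surjective; \<open>proj\<close>
  provides an explicit preimage.\<close>

lemma dual_extend:
  assumes "g \<in> carrier (dual_algebra K E)"
  shows "(\<lambda>c\<in>carrier C. g (proj c)) \<in> carrier (dual_algebra K C)"
    "restrict (\<lambda>c\<in>carrier C. g (proj c)) D = g"
proof -
  show "(\<lambda>c\<in>carrier C. g (proj c)) \<in> carrier (dual_algebra K C)"
    by (rule functional_restrict[OF module_C functional_proj[OF dual_algebraD(1)[OF assms]]])
  show "restrict (\<lambda>c\<in>carrier C. g (proj c)) D = g"
    using dual_algebraD(2)[OF assms]
    by (intro extensionalityI[of _ D]) (simp_all add: D_simps proj_id)
qed

text \<open>Restriction of functionals is dual to the coalgebra inclusion of D in C, hence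
  compatible with convolution.\<close>

lemma
  assumes "f \<in> carrier (dual_algebra K C)" "g \<in> carrier (dual_algebra K C)"
  shows restrict_add: "restrict (f \<oplus>\<^bsub>dual_algebra K C\<^esub> g) D = restrict f D \<oplus>\<^bsub>dual_algebra K E\<^esub> restrict g D"
    and restrict_mult: "restrict (f \<otimes>\<^bsub>dual_algebra K C\<^esub> g) D = restrict f D \<otimes>\<^bsub>dual_algebra K E\<^esub> restrict g D"
proof -
  interpret E: coalgebra K E by (rule coalgebra_E)
  show "restrict (f \<oplus>\<^bsub>dual_algebra K C\<^esub> g) D = restrict f D \<oplus>\<^bsub>dual_algebra K E\<^esub> restrict g D"
    by (auto simp: D_simps intro!: restrict_ext)
  show "restrict (f \<otimes>\<^bsub>dual_algebra K C\<^esub> g) D = restrict f D \<otimes>\<^bsub>dual_algebra K E\<^esub> restrict g D"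
    using E.conv_restrict[unfolded E_simps]
    by (auto simp: dual_algebra_mult D_simps conv_comult_E dual_algebraD(1)[OF assms(1)]
        dual_algebraD(1)[OF assms(2)] intro!: restrict_ext)
qed

lemma left_module_inflate:
  assumes "left_module (dual_algebra K E) M"
  shows "left_module (dual_algebra K C) (inflate D M)"
proof -
  interpret M: left_module "dual_algebra K E" M by fact
  show ?thesis
  proof (intro left_module.intro left_module_axioms.intro)
    show "ring (dual_algebra K C)" by (rule ring_dual_algebra)
    show "abelian_group (inflate D M)"
      by (rule abelian_group_inflate) (rule M.M.abelian_group_axioms)
    show "\<one>\<^bsub>dual_algebra K C\<^esub> \<odot>\<^bsub>inflate D M\<^esub> x = x" if "x \<in> carrier (inflate D M)" for x
      using that M.smult_one[of x] by simp
  qed (simp_all add: dual_restrict restrict_add restrict_mult M.smult_closed M.smult_l_distr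
      M.smult_r_distr M.smult_assoc del: dual_algebra_simps)
qed

text \<open>An equality of records: D inherits the counit of C, so a \<epsilon> restricts to its
  counterpart on D. Thus inflation preserves finite dimension.\<close>

lemma base_space_inflate: "base_space (dual_algebra K C) (inflate D M) = base_space (dual_algebra K E) M"
proof -
  have "restrict (a \<odot>\<^bsub>dual_algebra K C\<^esub> \<one>\<^bsub>dual_algebra K C\<^esub>) D = a \<odot>\<^bsub>dual_algebra K E\<^esub> \<one>\<^bsub>dual_algebra K E\<^esub>" for a
    using D_simps(1) by (auto intro!: restrict_ext)
  then show ?thesis
    by (simp add: base_space_def inflate_def)
qed

lemma lsum_inflate: "lsum (inflate D M) = lsum M"
  by (simp add: lsum_def fun_eq_iff)

text \<open>The same list works, since its second entries lie in D, where a functional and its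
  restriction agree.\<close>

lemma has_coefficients_inflate:
  assumes "has_coefficients K E M m xs"
  shows "has_coefficients K C (inflate D M) m xs"
proof -
  have xs: "set xs \<subseteq> carrier M \<times> D"
    using assms by (simp add: has_coefficients_def)
  show ?thesis
    unfolding has_coefficients_def base_space_inflate lsum_inflate
  proof (intro conjI ballI)
    show "set xs \<subseteq> carrier (inflate D M) \<times> carrier C"
      using xs D_simps(1) by auto
    fix f assume f: "f \<in> carrier (dual_algebra K C)"
    have "f \<odot>\<^bsub>inflate D M\<^esub> m = lsum M (\<lambda>(x, c). restrict f D c \<odot>\<^bsub>base_space (dual_algebra K E) M\<^esub> x) xs"
      using assms dual_restrict[OF f] by (simp add: has_coefficients_def del: base_space_simps(4))
    also have "\<dots> = lsum M (\<lambda>(x, c). f c \<odot>\<^bsub>base_space (dual_algebra K E) M\<^esub> x) xs"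
      using xs by (intro lsum_cong) (auto simp del: base_space_simps(4))
    finally show "f \<odot>\<^bsub>inflate D M\<^esub> m = \<dots>" .
  qed
qed

text \<open>A functional g on D acts on M exactly as its extension g \<circ> \<open>proj\<close>
  acts on the inflated module. The coefficients c of the latter enter only through g (proj c), so
  \<open>proj\<close> can be moved into the list.\<close>

lemma has_coefficients_of_inflate:
  assumes "has_coefficients K C (inflate D M) m xs"
  shows "has_coefficients K E M m (map (\<lambda>(x, c). (x, proj c)) xs)"
proof -
  have xs: "set xs \<subseteq> carrier M \<times> carrier C"
    using assms by (simp add: has_coefficients_def)
  show ?thesis
    unfolding has_coefficients_def
  proof (intro conjI ballI)
    show "set (map (\<lambda>(x, c). (x, proj c)) xs) \<subseteq> carrier M \<times> carrier E"
      using xs by (auto simp: proj_in)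
    fix g assume g: "g \<in> carrier (dual_algebra K E)"
    let ?f = "\<lambda>c\<in>carrier C. g (proj c)"
    have "g \<odot>\<^bsub>M\<^esub> m = ?f \<odot>\<^bsub>inflate D M\<^esub> m"
      by (simp only: inflate_simps dual_extend(2)[OF g])
    also have "\<dots> = lsum M (\<lambda>(x, c). ?f c \<odot>\<^bsub>base_space (dual_algebra K E) M\<^esub> x) xs"
      using assms dual_extend(1)[OF g] unfolding has_coefficients_def base_space_inflate lsum_inflate by blast
    also have "\<dots> = lsum M (\<lambda>(x, c). g (proj c) \<odot>\<^bsub>base_space (dual_algebra K E) M\<^esub> x) xs"
      using xs by (intro lsum_cong) (auto simp del: base_space_simps(4))
    also have "\<dots> = lsum M (\<lambda>(x, c). g c \<odot>\<^bsub>base_space (dual_algebra K E) M\<^esub> x)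
        (map (\<lambda>(x, c). (x, proj c)) xs)"
      by (simp add: lsum_map case_prod_unfold del: base_space_simps(4))
    finally show "g \<odot>\<^bsub>M\<^esub> m = \<dots>" .
  qed
qed

text \<open>Both directions are used: from D to C for the outer terms of an extension, from C to D
  for its middle term.\<close>

lemma rational_inflate_iff:
  assumes "left_module (dual_algebra K E) M"
  shows "rational_module K C (inflate D M) \<longleftrightarrow> rational_module K E M"
proof
  assume "rational_module K C (inflate D M)"
  then have "\<exists>xs. has_coefficients K E M m xs" if "m \<in> carrier M" for m
    using rational_module_has_coefficients[of K C "inflate D M" m] has_coefficients_of_inflate that by fastforce
  then show "rational_module K E M"
    by (rule coalgebra.rational_moduleI[OF coalgebra_E assms])
next
  assume "rational_module K E M"
  then have "\<exists>xs. has_coefficients K C (inflate D M) m xs" if "m \<in> carrier (inflate D M)" for m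
    using rational_module_has_coefficients[of K E M m] has_coefficients_inflate that by fastforce
  then show "rational_module K C (inflate D M)"
    by (rule rational_moduleI[OF left_module_inflate[OF assms]])
qed

lemma module_hom_inflate:
  "h \<in> module_hom (dual_algebra K E) L M \<Longrightarrow> h \<in> module_hom (dual_algebra K C) (inflate D L) (inflate D M)"
  by (simp add: module_hom_def dual_restrict)

lemma short_exact_inflate:
  "short_exact (dual_algebra K E) L i M p N \<Longrightarrow>
    short_exact (dual_algebra K C) (inflate D L) i (inflate D M) p (inflate D N)"
  by (simp add: short_exact_def module_hom_inflate)

text \<open>Inflation keeps carriers, so the type 'm over which modules range stays the same. P and
  Q are left open so that rationality with and without finite dimension are both instances.\<close>

lemma closed_under_extensions_inflate:
  assumes "closed_under_extensions (dual_algebra K C) P"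
    and "\<And>M :: ('c \<Rightarrow> 'k, 'm) module. left_module (dual_algebra K E) M \<Longrightarrow> P (inflate D M) \<longleftrightarrow> Q M"
  shows "closed_under_extensions (dual_algebra K E) Q"
  unfolding closed_under_extensions_def
proof (intro allI impI, elim conjE)
  fix L M N :: "('c \<Rightarrow> 'k, 'm) module" and i p
  assume *: "left_module (dual_algebra K E) L" "left_module (dual_algebra K E) M"
    "left_module (dual_algebra K E) N" "short_exact (dual_algebra K E) L i M p N" "Q L" "Q N"
  then have "P (inflate D M)"
    using assms(1)[unfolded closed_under_extensions_def, rule_format,
        of "inflate D L" "inflate D M" "inflate D N" i p]
    by (simp add: left_module_inflate short_exact_inflate assms(2))
  then show "Q M" using assms(2) * by blast
qed

end

theorem proposition3p6:
  fixes K :: "('k, 'r) ring_scheme"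
    and C :: "('k, 'c, 'x) coalgebra_scheme"
    and D :: "'c set"
  assumes "field K"
    and "coalgebra K C"
    and "subcoalgebra K D C"
  shows "(directly_coreflexive TYPE('m) K C \<longrightarrow>
            directly_coreflexive TYPE('m) K (subcoalgebra_struct K C D)) \<and>
         (left_torsion_Rat TYPE('m) K C \<longrightarrow>
            left_torsion_Rat TYPE('m) K (subcoalgebra_struct K C D))"
proof -
  interpret coalgebra_with_sub K C D
    using assms(2,3) by (simp add: coalgebra_with_sub_def coalgebra_with_sub_axioms_def)
  show ?thesis
    unfolding directly_coreflexive_def left_torsion_Rat_def
    \<comment> \<open>The remaining goals ask that each property be invariant under inflation; the
      dimension clause holds because the base space is unchanged.\<close>
    by (intro conjI impI; erule closed_under_extensions_inflate)
      (simp_all add: rational_inflate_iff base_space_inflate)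
qed

end
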